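(* Let $X$ be a small cover of dimension $n$. There exists a $2$-subtorus $G\subset\mathbb{Z}_2^n$ in general position if and only if $X$ is orientable. If such a $2$-subtorus exists, then it is unique.
   Context: $\mathbb{Z}_2$ is the group with two elements. All actions are smooth. Small cover: let $P$ be a simple polytope of dimension $n$. A small cover over $P$ is a smooth (closed, connected) $n$-manifold $X$ with a locally standard $\mathbb{Z}_2^n$-action (locally modelled, up to an automorphism of $\mathbb{Z}_2^n$, on the coordinatewise sign action of $\{\pm1\}^n$ on $\mathbb{R}^n$) such that the orbit space $X/\mathbb{Z}_2^n$ is diffeomorphic to $P$ as a manifold with corners. General position: let $\mathbb{Z}_2^{n-1}$ act on an $n$-manifold $X$. For a fixed point $x$, the tangent representation on $T_xX$ decomposes as a sum of $n$ one-dimensional real representations $V(\alpha_{x,j})$, $t\cdot y=\alpha_{x,j}(t)y$, with $\alpha_{x,j}\in\operatorname{Hom}(\mathbb{Z}_2^{n-1},\{\pm1\})\cong\mathbb{Z}_2^{n-1}$, called the weights at $x$. The action is in general position if for every fixed point $x$ any $n-1$ of the $n$ weights $\alpha_{x,1},\dots,\alpha_{x,n}$ are linearly independent over $\mathbb{Z}_2$. $2$-subtorus in general position: a subgroup $G\cong\mathbb{Z}_2^{n-1}$ of $\mathbb{Z}_2^n$ of index $2$ such that the restricted action of $G$ on the small cover $X$ is in general position. *)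

theory Defs
  imports "HOL-Analysis.Analysis" "HOL-Library.Z2"
begin

section \<open>Smooth maps between subsets of Euclidean spaces\<close>

text \<open>Differentiability of order \<open>k\<close>, meant for open sets \<open>S\<close>: all iterated directional
  derivatives up to order \<open>k\<close> exist and are continuous on \<open>S\<close>.\<close>

primrec higher_differentiable_on ::
  "nat \<Rightarrow> 'a::euclidean_space set \<Rightarrow> ('a \<Rightarrow> 'b::euclidean_space) \<Rightarrow> bool" where
  "higher_differentiable_on 0 S f \<longleftrightarrow> continuous_on S f"
| "higher_differentiable_on (Suc k) S f \<longleftrightarrow>
     (\<forall>x\<in>S. f differentiable (at x)) \<and>
     (\<forall>v. higher_differentiable_on k S (\<lambda>x. frechet_derivative f (at x) v))"

definition smooth_on :: "'a::euclidean_space set \<Rightarrow> ('a \<Rightarrow> 'b::euclidean_space) \<Rightarrow> bool" where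
  "smooth_on S f \<longleftrightarrow> (\<forall>k. higher_differentiable_on k S f)"

text \<open>On a subset that need not be open (such as a relatively open subset of an orthant or of a
  polytope), a map is smooth if it has local smooth extensions to the ambient space.\<close>

definition ext_smooth_on :: "'a::euclidean_space set \<Rightarrow> ('a \<Rightarrow> 'b::euclidean_space) \<Rightarrow> bool" where
  "ext_smooth_on S f \<longleftrightarrow>
     (\<forall>x\<in>S. \<exists>U F. open U \<and> x \<in> U \<and> smooth_on U F \<and> (\<forall>y\<in>S \<inter> U. F y = f y))"


section \<open>Smooth manifolds\<close>

text \<open>The manifold is the type \<open>'x\<close>; a chart is a pair of a domain and a map that is relevant only
  on that domain. The dimension is \<open>CARD('n)\<close>.\<close>

type_synonym ('x, 'n) chart = "'x set \<times> ('x \<Rightarrow> real^'n)"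

abbreviation cdom :: "('x, 'n) chart \<Rightarrow> 'x set" where "cdom \<equiv> fst"
abbreviation cmap :: "('x, 'n) chart \<Rightarrow> 'x \<Rightarrow> real^'n" where "cmap \<equiv> snd"

definition cinv :: "('x, 'n) chart \<Rightarrow> real^'n \<Rightarrow> 'x" where
  "cinv c = the_inv_into (cdom c) (cmap c)"

definition is_chart :: "('x::topological_space, 'n::finite) chart \<Rightarrow> bool" where
  "is_chart c \<longleftrightarrow> open (cdom c) \<and> open (cmap c ` cdom c) \<and>
     homeomorphism (cdom c) (cmap c ` cdom c) (cmap c) (cinv c)"

definition transition :: "('x, 'n) chart \<Rightarrow> ('x, 'n) chart \<Rightarrow> real^'n \<Rightarrow> real^'n" where
  "transition c d = cmap d \<circ> cinv c"

definition compatible :: "('x, 'n::finite) chart \<Rightarrow> ('x, 'n) chart \<Rightarrow> bool" where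
  "compatible c d \<longleftrightarrow>
     smooth_on (cmap c ` (cdom c \<inter> cdom d)) (transition c d) \<and>
     smooth_on (cmap d ` (cdom c \<inter> cdom d)) (transition d c)"

definition smooth_atlas :: "('x::topological_space, 'n::finite) chart set \<Rightarrow> bool" where
  "smooth_atlas A \<longleftrightarrow> (\<forall>c\<in>A. is_chart c) \<and> (\<Union>c\<in>A. cdom c) = UNIV \<and>
     (\<forall>c\<in>A. \<forall>d\<in>A. compatible c d)"

text \<open>The maximal atlas generated by \<open>A\<close>.\<close>

definition smooth_charts ::
  "('x::topological_space, 'n::finite) chart set \<Rightarrow> ('x, 'n) chart set" where
  "smooth_charts A = {c. is_chart c \<and> (\<forall>d\<in>A. compatible c d)}"

definition smooth_self_map ::
  "('x::topological_space, 'n::finite) chart set \<Rightarrow> ('x \<Rightarrow> 'x) \<Rightarrow> bool" where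
  "smooth_self_map A f \<longleftrightarrow> continuous_on UNIV f \<and>
     (\<forall>c\<in>A. \<forall>d\<in>A. smooth_on (cmap c ` (cdom c \<inter> f -` cdom d)) (cmap d \<circ> f \<circ> cinv c))"

definition orientable :: "('x::topological_space, 'n::finite) chart set \<Rightarrow> bool" where
  "orientable A \<longleftrightarrow>
     (\<exists>B\<subseteq>smooth_charts A. (\<Union>c\<in>B. cdom c) = UNIV \<and>
        (\<forall>c\<in>B. \<forall>d\<in>B. \<forall>y\<in>cmap c ` (cdom c \<inter> cdom d).
           det (matrix (frechet_derivative (transition c d) (at y))) > 0))"


section \<open>Smooth and locally standard actions of \<open>\<int>\<^sub>2\<^sup>n\<close>\<close>

text \<open>The group \<open>\<int>\<^sub>2\<^sup>n\<close> is the additive group of \<open>bit ^ 'n\<close>, where \<open>bit\<close> is the two-element field.\<close>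

definition smooth_action ::
  "('x::topological_space, 'n::finite) chart set \<Rightarrow> (bit^'n \<Rightarrow> 'x \<Rightarrow> 'x) \<Rightarrow> bool" where
  "smooth_action A act \<longleftrightarrow> act 0 = id \<and> (\<forall>g h. act (g + h) = act g \<circ> act h) \<and>
     (\<forall>g. smooth_self_map A (act g))"

definition bit_sign :: "bit \<Rightarrow> real" where
  "bit_sign b = (if b = 0 then 1 else - 1)"

definition sign_action :: "bit^'n \<Rightarrow> real^'n \<Rightarrow> real^'n" where
  "sign_action g y = (\<chi> i. bit_sign (g $ i) * y $ i)"

definition group_automorphism :: "(bit^'n \<Rightarrow> bit^'n) \<Rightarrow> bool" where
  "group_automorphism \<theta> \<longleftrightarrow> bij \<theta> \<and> (\<forall>g h. \<theta> (g + h) = \<theta> g + \<theta> h)"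

definition standard_chart ::
  "('x::topological_space, 'n::finite) chart set \<Rightarrow> (bit^'n \<Rightarrow> 'x \<Rightarrow> 'x) \<Rightarrow> ('x, 'n) chart \<Rightarrow> bool"
where
  "standard_chart A act c \<longleftrightarrow> c \<in> smooth_charts A \<and> (\<forall>g. act g ` cdom c \<subseteq> cdom c) \<and>
     (\<exists>\<theta>. group_automorphism \<theta> \<and>
        (\<forall>g. \<forall>x\<in>cdom c. cmap c (act g x) = sign_action (\<theta> g) (cmap c x)))"

definition locally_standard ::
  "('x::topological_space, 'n::finite) chart set \<Rightarrow> (bit^'n \<Rightarrow> 'x \<Rightarrow> 'x) \<Rightarrow> bool" where
  "locally_standard A act \<longleftrightarrow> (\<forall>x. \<exists>c. x \<in> cdom c \<and> standard_chart A act c)"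


section \<open>The orbit space as a manifold with corners\<close>

definition orbit :: "(bit^'n \<Rightarrow> 'x \<Rightarrow> 'x) \<Rightarrow> 'x \<Rightarrow> 'x set" where
  "orbit act x = range (\<lambda>g. act g x)"

definition orbit_space :: "(bit^'n \<Rightarrow> 'x::topological_space \<Rightarrow> 'x) \<Rightarrow> 'x set topology" where
  "orbit_space act = topology (\<lambda>W. W \<subseteq> range (orbit act) \<and> open (orbit act -` W))"

lemma openin_orbit_space:
  "openin (orbit_space act) W \<longleftrightarrow> W \<subseteq> range (orbit act) \<and> open (orbit act -` W)"
proof -
  have "istopology (\<lambda>W. W \<subseteq> range (orbit act) \<and> open (orbit act -` W))"
    unfolding istopology_def
  proof (intro conjI allI impI)
    fix S T assume "S \<subseteq> range (orbit act) \<and> open (orbit act -` S)"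
      and "T \<subseteq> range (orbit act) \<and> open (orbit act -` T)"
    then show "S \<inter> T \<subseteq> range (orbit act)" "open (orbit act -` (S \<inter> T))"
      by (blast, simp add: vimage_Int open_Int)
  next
    fix \<W> assume *: "\<forall>W\<in>\<W>. W \<subseteq> range (orbit act) \<and> open (orbit act -` W)"
    then show "\<Union>\<W> \<subseteq> range (orbit act)" by blast
    show "open (orbit act -` \<Union>\<W>)"
      unfolding vimage_Union using * by (intro open_UN) blast
  qed
  then show ?thesis
    by (simp add: orbit_space_def topology_inverse')
qed

lemma topspace_orbit_space: "topspace (orbit_space act) = range (orbit act)"
proof (rule antisym)
  show "topspace (orbit_space act) \<subseteq> range (orbit act)"
    using openin_topspace[of "orbit_space act"] unfolding openin_orbit_space by (rule conjunct1)
  have "orbit act -` range (orbit act) = UNIV" by blast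
  then have "openin (orbit_space act) (range (orbit act))"
    unfolding openin_orbit_space by simp
  then show "range (orbit act) \<subseteq> topspace (orbit_space act)"
    by (rule openin_subset)
qed

text \<open>The quotient of \<open>\<real>\<^sup>n\<close> by the sign action is identified with the orthant by
  \<open>(y\<^sub>1, \<dots>, y\<^sub>n) \<mapsto> (y\<^sub>1\<^sup>2, \<dots>, y\<^sub>n\<^sup>2)\<close>, so that smooth functions on the orbit space correspond to
  invariant smooth functions upstairs. A standard chart \<open>c\<close> thereby induces a corner chart of the
  orbit space, with values in the orthant and with domain the set of orbits in \<open>cdom c\<close>. Its value
  does not depend on the chosen representative of the orbit.\<close>

definition orbit_chart :: "('x, 'n) chart \<Rightarrow> 'x set \<Rightarrow> real^'n" where
  "orbit_chart c w = (let x = (SOME x. x \<in> w) in \<chi> i. (cmap c x $ i)\<^sup>2)"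

text \<open>Diffeomorphisms from the orbit space onto a subset \<open>P\<close> of \<open>\<real>\<^sup>n\<close>. By Whitney's theorem on
  even functions, the corner charts induced by different standard charts are smoothly compatible;
  it is therefore enough to test smoothness in one corner chart around each orbit.\<close>

definition orbit_space_diffeo ::
  "('x::topological_space, 'n::finite) chart set \<Rightarrow> (bit^'n \<Rightarrow> 'x \<Rightarrow> 'x) \<Rightarrow>
   (real^'n) set \<Rightarrow> ('x set \<Rightarrow> real^'n) \<Rightarrow> bool" where
  "orbit_space_diffeo A act P h \<longleftrightarrow>
     homeomorphic_map (orbit_space act) (top_of_set P) h \<and>
     (\<forall>x. \<exists>c. x \<in> cdom c \<and> standard_chart A act c \<and>
        (let W = orbit act ` cdom c in
           ext_smooth_on (orbit_chart c ` W) (h \<circ> the_inv_into W (orbit_chart c)) \<and>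
           ext_smooth_on (h ` W) (orbit_chart c \<circ> the_inv_into W h)))"


section \<open>Small covers\<close>

definition simple_polytope :: "(real^'n::finite) set \<Rightarrow> bool" where
  "simple_polytope P \<longleftrightarrow> polytope P \<and> aff_dim P = int CARD('n) \<and>
     (\<forall>v. v extreme_point_of P \<longrightarrow> card {F. F facet_of P \<and> v \<in> F} = CARD('n))"

definition small_cover ::
  "('x::{t2_space, second_countable_topology}, 'n::finite) chart set \<Rightarrow>
   (bit^'n \<Rightarrow> 'x \<Rightarrow> 'x) \<Rightarrow> (real^'n) set \<Rightarrow> bool" where
  "small_cover A act P \<longleftrightarrow>
     smooth_atlas A \<and> compact (UNIV :: 'x set) \<and> connected (UNIV :: 'x set) \<and>
     smooth_action A act \<and> locally_standard A act \<and>
     simple_polytope P \<and> (\<exists>h. orbit_space_diffeo A act P h)"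


section \<open>Actions in general position\<close>

text \<open>The tangent space at a fixed point \<open>x\<close> is identified with \<open>\<real>\<^sup>n\<close> by a chart \<open>c\<close> around \<open>x\<close>;
  this is the tangent representation in these coordinates.\<close>

definition tangent_rep ::
  "('x, 'n::finite) chart \<Rightarrow> (bit^'n \<Rightarrow> 'x \<Rightarrow> 'x) \<Rightarrow> 'x \<Rightarrow> bit^'n \<Rightarrow> real^'n \<Rightarrow> real^'n" where
  "tangent_rep c act x g =
     frechet_derivative (cmap c \<circ> act g \<circ> cinv c) (at (cmap c x))"

text \<open>\<open>\<alpha>\<close> is the family of the \<open>n\<close> weights at \<open>x\<close> of the action restricted to the subgroup \<open>G\<close>,
  listed along a basis \<open>b\<close> of the tangent space consisting of common eigenvectors. Weights are
  homomorphisms from \<open>G\<close> to \<open>\<int>\<^sub>2\<close>, with \<open>bit_sign \<circ> \<alpha> j\<close> as the corresponding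
  homomorphism to \<open>{1, -1}\<close>; only the values on \<open>G\<close> matter.\<close>

definition weights_at ::
  "('x::topological_space, 'n::finite) chart set \<Rightarrow> (bit^'n \<Rightarrow> 'x \<Rightarrow> 'x) \<Rightarrow> (bit^'n) set \<Rightarrow> 'x \<Rightarrow>
   ('n \<Rightarrow> bit^'n \<Rightarrow> bit) \<Rightarrow> bool" where
  "weights_at A act G x \<alpha> \<longleftrightarrow>
     (\<forall>j. \<forall>g\<in>G. \<forall>h\<in>G. \<alpha> j (g + h) = \<alpha> j g + \<alpha> j h) \<and>
     (\<exists>c\<in>smooth_charts A. x \<in> cdom c \<and>
        (\<exists>b :: 'n \<Rightarrow> real^'n. inj b \<and> independent (range b) \<and>
           (\<forall>j. \<forall>g\<in>G. tangent_rep c act x g (b j) = bit_sign (\<alpha> j g) *\<^sub>R b j)))"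

text \<open>Linear independence over \<open>\<int>\<^sub>2\<close> of the family \<open>(\<alpha> j)\<close>, \<open>j \<in> J\<close>, of functions on \<open>G\<close>;
  repeated members count as dependent.\<close>

definition weights_independent ::
  "(bit^'n) set \<Rightarrow> 'n set \<Rightarrow> ('n \<Rightarrow> bit^'n \<Rightarrow> bit) \<Rightarrow> bool" where
  "weights_independent G J \<alpha> \<longleftrightarrow>
     (\<forall>a :: 'n \<Rightarrow> bit. (\<forall>g\<in>G. (\<Sum>j\<in>J. a j * \<alpha> j g) = 0) \<longrightarrow> (\<forall>j\<in>J. a j = 0))"

text \<open>The weights at a fixed point are unique up to order, hence the existential quantifier.\<close>

definition general_position ::
  "('x::topological_space, 'n::finite) chart set \<Rightarrow> (bit^'n \<Rightarrow> 'x \<Rightarrow> 'x) \<Rightarrow> (bit^'n) set \<Rightarrow> bool"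
where
  "general_position A act G \<longleftrightarrow>
     (\<forall>x. (\<forall>g\<in>G. act g x = x) \<longrightarrow>
        (\<exists>\<alpha>. weights_at A act G x \<alpha> \<and>
           (\<forall>J. card J = CARD('n) - 1 \<longrightarrow> weights_independent G J \<alpha>)))"

text \<open>Subgroups of index 2; these are automatically isomorphic to \<open>\<int>\<^sub>2\<^sup>n\<^sup>-\<^sup>1\<close>.\<close>

definition index2_subgroup :: "(bit^'n) set \<Rightarrow> bool" where
  "index2_subgroup G \<longleftrightarrow> 0 \<in> G \<and> (\<forall>g\<in>G. \<forall>h\<in>G. g + h \<in> G) \<and> (\<forall>g\<in>G. - g \<in> G) \<and>
     card (range (\<lambda>g. (\<lambda>h. g + h) ` G)) = 2"

definition two_subtorus_in_general_position ::
  "('x::topological_space, 'n::finite) chart set \<Rightarrow> (bit^'n \<Rightarrow> 'x \<Rightarrow> 'x) \<Rightarrow> (bit^'n) set \<Rightarrow> bool"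
where
  "two_subtorus_in_general_position A act G \<longleftrightarrow>
     index2_subgroup G \<and> general_position A act G"

end

theory Submission
  imports Defs
begin

text \<open>
  Let \<open>X\<close> be a small cover. An element of \<open>\<int>\<^sub>2\<^sup>n\<close> is called a reflection if it generates the stabilizer
  of some point, and a homomorphism \<open>\<epsilon>\<close> from \<open>\<int>\<^sub>2\<^sup>n\<close> to \<open>\<int>\<^sub>2\<close> is called reflective if \<open>\<epsilon> r = 1\<close> for
  every reflection \<open>r\<close>. Everything is expressed through reflective homomorphisms.

  Fixed points. Every mirror, that is, the set of points near which a given \<open>r\<close> acts as
  a reflection, contains a point fixed by the whole group (\<open>reflection_at_fixed_point\<close>). Indeed, a
  point of the mirror that the orbit map \<open>X \<rightarrow> P\<close> sends furthest from the origin lies over a vertex: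
  in a corner chart the derivative of the orbit map in squared coordinates takes the
  directions tangent to the stratum of a point onto the directions in which \<open>P\<close> extends both ways, so
  at any other point one could move further out along a segment in \<open>P\<close> without leaving the mirror.

  Uniqueness. At a global fixed point the coordinate reflections of a standard chart form a basis of
  \<open>\<int>\<^sub>2\<^sup>n\<close>. Hence there is at most one reflective homomorphism (\<open>reflective_unique\<close>).

  General position. At a global fixed point the weights of an index two subgroup \<open>G\<close> are, up to
  order, the coordinates \<open>\<theta>\<^sub>1, \<dots>, \<theta>\<^sub>n\<close> of a standard chart restricted to \<open>G\<close>. Their only linear relation
  is \<open>\<Sum> \<epsilon>(r\<^sub>i) \<theta>\<^sub>i = 0\<close>, where \<open>G\<close> is the kernel of \<open>\<epsilon>\<close> and \<open>r\<^sub>i\<close> are the coordinate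
  reflections. Any \<open>n - 1\<close> weights are independent exactly when all \<open>\<epsilon>(r\<^sub>i)\<close> are \<open>1\<close>. Thus the
  subgroups in general position are the kernels of the reflective homomorphisms
  (\<open>two_subtorus_reflective\<close>, \<open>reflective_two_subtorus\<close>).

  Orientability. If \<open>X\<close> is oriented, then each group element preserves or reverses the orientation,
  uniformly because \<open>X\<close> is connected, and reflections reverse it. This gives a reflective homomorphism
  (\<open>orientable_reflective\<close>). Conversely, a reflective \<open>\<epsilon>\<close> allows one to orient every standard chart so
  that \<open>g\<close> changes the orientation by the sign of \<open>\<epsilon> g\<close>. The signs comparing these orientations on
  overlaps are locally constant and invariant, so they live on \<open>P\<close>. As \<open>P\<close> is compact and convex,
  they form a cocycle that is a coboundary (\<open>cocycle_convex\<close>), and the chart orientations can be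
  adjusted to agree (\<open>reflective_orientable\<close>).
\<close>


section \<open>The groups of bit vectors and their sign representations\<close>

text \<open>Sums and products of bits are kept in their arithmetic form.\<close>

declare add_bit_eq_xor [simp del] mult_bit_eq_and [simp del]

lemma bit_add_self [simp]: "b + b = (0::bit)"
  by (cases b) simp_all

lemma bit_vec_add_self [simp]: "g + g = (0::bit^'n)"
  by (simp add: vec_eq_iff)

lemma bit_vec_add_cancel [simp]: "g + (g + h) = (h::bit^'n)"
  by (metis add.assoc add_0 bit_vec_add_self)

lemma bit_vec_uminus [simp]: "- g = (g::bit^'n)"
  by (simp add: vec_eq_iff)

lemma bit_sign_0 [simp]: "bit_sign 0 = 1" and bit_sign_1 [simp]: "bit_sign 1 = -1"
  by (simp_all add: bit_sign_def)

lemma bit_sign_add: "bit_sign (a + b) = bit_sign a * bit_sign b"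
  by (cases a; cases b) (simp_all add: bit_sign_def)

lemma bit_sign_cases: "bit_sign b = 1 \<or> bit_sign b = -1"
  by (simp add: bit_sign_def)

lemma bit_sign_eq_iff [simp]: "bit_sign a = bit_sign b \<longleftrightarrow> a = b"
  by (cases a; cases b) simp_all

lemma bit_sign_square [simp]: "bit_sign b * bit_sign b = 1"
  using bit_sign_cases[of b] by auto

lemma bit_sign_nonzero [simp]: "bit_sign b \<noteq> 0"
  using bit_sign_cases[of b] by auto

lemma bit_sign_sum: "bit_sign (\<Sum>i\<in>I. f i) = (\<Prod>i\<in>I. bit_sign (f i))"
  by (induction I rule: infinite_finite_induct) (simp_all add: bit_sign_add)

lemma sign_action_nth [simp]: "sign_action g y $ i = bit_sign (g $ i) * y $ i"
  by (simp add: sign_action_def)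

lemma sign_action_involution [simp]: "sign_action g (sign_action g y) = y"
  by (simp add: vec_eq_iff flip: mult.assoc)

lemma linear_sign_action: "linear (sign_action g)"
  by (rule linearI) (simp_all add: vec_eq_iff algebra_simps)

lemma bounded_linear_sign_action: "bounded_linear (sign_action g)"
  by (simp add: linear_sign_action linear_conv_bounded_linear[symmetric])

lemma sign_action_has_derivative: "(sign_action g has_derivative sign_action g) (at y within S)"
  by (rule bounded_linear_imp_has_derivative[OF bounded_linear_sign_action])

text \<open>The determinant of the diagonal matrix by which a bit vector acts.\<close>

definition total_sign :: "bit^'n::finite \<Rightarrow> real" where
  "total_sign g = (\<Prod>i\<in>UNIV. bit_sign (g $ i))"

lemma det_sign_action: "det (matrix (sign_action g)) = total_sign g"
proof -
  have "det (matrix (sign_action g)) = (\<Prod>i\<in>UNIV. matrix (sign_action g) $ i $ i)"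
    by (rule det_diagonal) (simp add: matrix_def axis_def)
  then show ?thesis
    by (simp add: total_sign_def matrix_def)
qed

lemma total_sign_cases: "total_sign g = 1 \<or> total_sign g = -1"
proof -
  have "total_sign g = bit_sign (\<Sum>i\<in>UNIV. g $ i)"
    by (simp add: total_sign_def bit_sign_sum)
  then show ?thesis using bit_sign_cases by metis
qed

lemma total_sign_square [simp]: "total_sign g * total_sign g = 1"
  using total_sign_cases[of g] by auto

lemma total_sign_add: "total_sign (g + h) = total_sign g * total_sign h"
  by (simp add: total_sign_def bit_sign_add prod.distrib)

lemma total_sign_axis: "total_sign (axis i 1) = -1"
proof -
  have "bit_sign (axis i 1 $ j) = (if j = i then -1 else 1)" for j
    by (simp add: axis_def)
  then show ?thesis
    by (simp add: total_sign_def prod.delta)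
qed

lemma automorphism_add: "group_automorphism \<theta> \<Longrightarrow> \<theta> (g + h) = \<theta> g + \<theta> h"
  by (simp add: group_automorphism_def)

lemma automorphism_inj: "group_automorphism \<theta> \<Longrightarrow> \<theta> g = \<theta> h \<longleftrightarrow> g = h"
  by (meson bij_betw_def group_automorphism_def inj_eq)

lemma automorphism_zero [simp]: "group_automorphism \<theta> \<Longrightarrow> \<theta> 0 = 0"
  using automorphism_add[of \<theta> 0 0] by simp

lemma automorphism_eq_0_iff: "group_automorphism \<theta> \<Longrightarrow> \<theta> g = 0 \<longleftrightarrow> g = 0"
  using automorphism_inj[of \<theta> g 0] by simp

lemma automorphism_inv: "group_automorphism \<theta> \<Longrightarrow> \<theta> (inv \<theta> v) = v"
  by (simp add: group_automorphism_def bij_is_surj surj_f_inv_f)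

lemma automorphism_inv_inv: "group_automorphism \<theta> \<Longrightarrow> inv \<theta> (\<theta> g) = g"
  by (simp add: group_automorphism_def bij_is_inj)

lemma automorphism_inv_add:
  "group_automorphism \<theta> \<Longrightarrow> inv \<theta> (v + w) = inv \<theta> v + inv \<theta> w"
  using automorphism_add[of \<theta> "inv \<theta> v" "inv \<theta> w"]
  by (metis automorphism_inv automorphism_inv_inv)

text \<open>Homomorphisms to the two-element group.\<close>

abbreviation additive :: "(bit^'n \<Rightarrow> bit) \<Rightarrow> bool" where
  "additive \<epsilon> \<equiv> (\<forall>g h. \<epsilon> (g + h) = \<epsilon> g + \<epsilon> h)"

lemma additive_zero: "additive \<epsilon> \<Longrightarrow> \<epsilon> 0 = 0"
  by (metis add_cancel_right_right add_0)

lemma additive_sum: "additive \<epsilon> \<Longrightarrow> \<epsilon> (\<Sum>i\<in>I. f i) = (\<Sum>i\<in>I. \<epsilon> (f i))"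
  by (induction I rule: infinite_finite_induct) (simp_all add: additive_zero)

lemma bit_vec_sum_axis: "v = (\<Sum>i\<in>UNIV. if v $ i = 1 then axis i 1 else 0)" for v :: "bit^'n"
proof -
  have "(\<Sum>i\<in>UNIV. if v $ i = 1 then axis i (1::bit) else 0) $ j = v $ j" for j
  proof -
    have "(\<Sum>i\<in>UNIV. if v $ i = 1 then axis i (1::bit) else 0) $ j
        = (\<Sum>i\<in>UNIV. if i = j then v $ j else 0)"
      unfolding sum_component by (rule sum.cong) (auto simp: axis_def)
    then show ?thesis by simp
  qed
  then show ?thesis by (simp add: vec_eq_iff)
qed

text \<open>A homomorphism to the two-element group in the coordinates given by an automorphism.\<close>

lemma additive_coordinates:
  assumes "additive \<epsilon>" and \<theta>: "group_automorphism \<theta>"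
  shows "\<epsilon> g = (\<Sum>i\<in>UNIV. \<theta> g $ i * \<epsilon> (inv \<theta> (axis i 1)))"
proof -
  have inv0: "inv \<theta> 0 = 0"
    by (metis \<theta> automorphism_inv_inv automorphism_zero)
  have add: "additive (\<lambda>v. \<epsilon> (inv \<theta> v))"
    using assms by (simp add: automorphism_inv_add)
  have "\<epsilon> g = \<epsilon> (inv \<theta> (\<theta> g))"
    using \<theta> by (simp add: automorphism_inv_inv)
  also have "\<dots> = \<epsilon> (inv \<theta> (\<Sum>i\<in>UNIV. if \<theta> g $ i = 1 then axis i 1 else 0))"
    by (subst (1) bit_vec_sum_axis[of "\<theta> g"]) simp
  also have "\<dots> = (\<Sum>i\<in>UNIV. \<epsilon> (inv \<theta> (if \<theta> g $ i = 1 then axis i 1 else 0)))"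
    by (rule additive_sum[OF add])
  also have "\<dots> = (\<Sum>i\<in>UNIV. \<theta> g $ i * \<epsilon> (inv \<theta> (axis i 1)))"
  proof (rule sum.cong[OF refl])
    fix i
    show "\<epsilon> (inv \<theta> (if \<theta> g $ i = 1 then axis i 1 else 0)) = \<theta> g $ i * \<epsilon> (inv \<theta> (axis i 1))"
      using inv0 additive_zero[OF assms(1)] by (cases "\<theta> g $ i") auto
  qed
  finally show ?thesis .
qed


section \<open>Calculus in charts\<close>

lemma smooth_on_differentiable: "smooth_on S f \<Longrightarrow> x \<in> S \<Longrightarrow> f differentiable (at x)"
  using higher_differentiable_on.simps(2)[of 0 S f] unfolding smooth_on_def by blast

lemma smooth_on_has_derivative:
  "smooth_on S f \<Longrightarrow> x \<in> S \<Longrightarrow> (f has_derivative frechet_derivative f (at x)) (at x)"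
  using smooth_on_differentiable frechet_derivative_works by blast

lemma smooth_on_continuous_derivative:
  "smooth_on S f \<Longrightarrow> continuous_on S (\<lambda>x. frechet_derivative f (at x) v)"
  using higher_differentiable_on.simps(2)[of 0 S f] unfolding smooth_on_def by simp

lemma chart_cinv_cmap: "is_chart c \<Longrightarrow> x \<in> cdom c \<Longrightarrow> cinv c (cmap c x) = x"
  unfolding is_chart_def homeomorphism_def by blast

lemma chart_open_dom: "is_chart c \<Longrightarrow> open (cdom c)"
  by (simp add: is_chart_def)

lemma chart_continuous: "is_chart c \<Longrightarrow> continuous_on (cdom c) (cmap c)"
  by (simp add: is_chart_def homeomorphism_def)

lemma chart_open_image:
  assumes "is_chart c" "open S" "S \<subseteq> cdom c"
  shows "open (cmap c ` S)"
proof -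
  have "openin (top_of_set (cmap c ` cdom c)) (cmap c ` S)"
    using assms unfolding is_chart_def
    by (meson homeomorphism_imp_open_map openin_open_eq)
  then show ?thesis
    using assms(1) openin_open_trans unfolding is_chart_def by blast
qed

lemma chart_open_vimage:
  assumes "is_chart c" "open T"
  shows "open {x \<in> cdom c. cmap c x \<in> T}"
proof -
  have "open (cdom c \<inter> cmap c -` T)"
    using assms by (intro continuous_open_preimage chart_continuous chart_open_dom)
  then show ?thesis by (simp add: Int_def vimage_def)
qed

lemma chart_inj: "is_chart c \<Longrightarrow> x \<in> cdom c \<Longrightarrow> y \<in> cdom c \<Longrightarrow> cmap c x = cmap c y \<Longrightarrow> x = y"
  by (metis chart_cinv_cmap)

lemma smooth_chartsD:
  assumes "c \<in> smooth_charts A"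
  shows "is_chart c" and "a \<in> A \<Longrightarrow> compatible c a"
  using assms by (auto simp: smooth_charts_def)

lemma compatible_sym: "compatible c d \<longleftrightarrow> compatible d c"
  by (auto simp: compatible_def Int_commute)

text \<open>The derivative at \<open>x\<close> of the change of coordinates from \<open>c\<close> to \<open>d\<close>, and the sign of its
  determinant.\<close>

definition tder :: "('x, 'n::finite) chart \<Rightarrow> ('x, 'n) chart \<Rightarrow> 'x \<Rightarrow> real^'n \<Rightarrow> real^'n" where
  "tder c d x = frechet_derivative (transition c d) (at (cmap c x))"

definition jac_sign :: "('x, 'n::finite) chart \<Rightarrow> ('x, 'n) chart \<Rightarrow> 'x \<Rightarrow> real" where
  "jac_sign c d x = sgn (det (matrix (tder c d x)))"

lemma transition_cmap: "is_chart c \<Longrightarrow> x \<in> cdom c \<Longrightarrow> transition c d (cmap c x) = cmap d x"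
  by (simp add: transition_def chart_cinv_cmap)

lemma compatible_has_derivative:
  assumes "compatible c d" "x \<in> cdom c" "x \<in> cdom d"
  shows "(transition c d has_derivative tder c d x) (at (cmap c x))"
  using assms smooth_on_has_derivative unfolding compatible_def tder_def by blast

text \<open>The chain rule for two successive changes of coordinates.\<close>

lemma transition_compose_has_derivative:
  assumes c: "is_chart c" and a: "is_chart a" and d: "is_chart d"
    and x: "x \<in> cdom c" "x \<in> cdom a" "x \<in> cdom d"
    and f: "(transition c a has_derivative f) (at (cmap c x))"
    and g: "(transition a d has_derivative g) (at (cmap a x))"
  shows "(transition c d has_derivative g \<circ> f) (at (cmap c x))"
proof (rule has_derivative_transform_within_open)
  show "(transition a d \<circ> transition c a has_derivative g \<circ> f) (at (cmap c x))"
    by (rule diff_chain_at[OF f]) (simp add: transition_cmap c x g)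
  show "open (cmap c ` (cdom c \<inter> cdom a \<inter> cdom d))"
    using c a d by (intro chart_open_image) (auto simp: chart_open_dom open_Int)
  show "cmap c x \<in> cmap c ` (cdom c \<inter> cdom a \<inter> cdom d)"
    using x by blast
  show "(transition a d \<circ> transition c a) y = transition c d y"
    if "y \<in> cmap c ` (cdom c \<inter> cdom a \<inter> cdom d)" for y
    using that c a d by (auto simp: transition_cmap)
qed

lemma tder_self:
  assumes "is_chart c" "x \<in> cdom c"
  shows "tder c c x = id"
proof -
  have "(transition c c has_derivative id) (at (cmap c x))"
  proof (rule has_derivative_transform_within_open)
    show "(id has_derivative id) (at (cmap c x))"
      by (simp add: has_derivative_id eq_id_iff[symmetric] id_def)
    show "open (cmap c ` cdom c)" "cmap c x \<in> cmap c ` cdom c"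
      using assms by (auto simp: is_chart_def)
    show "id y = transition c c y" if "y \<in> cmap c ` cdom c" for y
      using that assms by (auto simp: transition_cmap)
  qed
  then show ?thesis
    unfolding tder_def by (metis frechet_derivative_at)
qed

lemma det_matrix_compose:
  assumes "linear (f :: real^'n \<Rightarrow> real^'n)" "linear (g :: real^'n \<Rightarrow> real^'n)"
  shows "det (matrix (g \<circ> f)) = det (matrix g) * det (matrix f)"
  by (simp add: matrix_compose[OF assms] det_mul)

text \<open>A smooth manifold, given by an atlas on the whole type.\<close>

locale smooth_mfd =
  fixes A :: "('x::topological_space, 'n::finite) chart set"
  assumes atlas: "smooth_atlas A"
begin

text \<open>All charts of the maximal atlas.\<close>

abbreviation "M \<equiv> smooth_charts A"

lemma atlas_chart: "a \<in> A \<Longrightarrow> is_chart a"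
  using atlas by (simp add: smooth_atlas_def)

lemma atlas_smooth_chart: "a \<in> A \<Longrightarrow> a \<in> M"
  using atlas by (simp add: smooth_atlas_def smooth_charts_def)

lemma atlas_cover: obtains a where "a \<in> A" "x \<in> cdom a"
  using atlas unfolding smooth_atlas_def by blast

lemma transition_has_derivative:
  assumes c: "c \<in> M" and d: "d \<in> M" and x: "x \<in> cdom c" "x \<in> cdom d"
  shows "(transition c d has_derivative tder c d x) (at (cmap c x))"
proof -
  obtain a where a: "a \<in> A" "x \<in> cdom a" by (rule atlas_cover)
  have ca: "compatible c a" and ad: "compatible a d"
    using c d a compatible_sym smooth_chartsD by blast+
  have "(transition c d has_derivative tder a d x \<circ> tder c a x) (at (cmap c x))"
    using transition_compose_has_derivative[of c a d x] ca ad c d a x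
    by (metis atlas_chart compatible_has_derivative smooth_chartsD(1))
  then show ?thesis
    unfolding tder_def using frechet_derivative_at by fastforce
qed

lemma tder_linear:
  assumes "c \<in> M" "d \<in> M" "x \<in> cdom c" "x \<in> cdom d"
  shows "linear (tder c d x)"
  using transition_has_derivative[OF assms] has_derivative_linear by blast

lemma tder_compose:
  assumes c: "c \<in> M" and d: "d \<in> M" and e: "e \<in> M"
    and x: "x \<in> cdom c" "x \<in> cdom d" "x \<in> cdom e"
  shows "tder c e x = tder d e x \<circ> tder c d x"
proof -
  have "(transition c e has_derivative tder d e x \<circ> tder c d x) (at (cmap c x))"
    using transition_compose_has_derivative[of c d e x] transition_has_derivative
      c d e x smooth_chartsD(1) by blast
  then show ?thesis
    unfolding tder_def[of c e] using frechet_derivative_at by fastforce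
qed

lemma tder_inverse:
  assumes "c \<in> M" "d \<in> M" "x \<in> cdom c" "x \<in> cdom d"
  shows "tder d c x (tder c d x v) = v"
  using tder_compose[of c d c x] tder_self[OF smooth_chartsD(1)[OF assms(1)] assms(3)] assms
  by (metis comp_apply id_apply)

lemma det_tder_compose:
  assumes "c \<in> M" "d \<in> M" "e \<in> M" "x \<in> cdom c" "x \<in> cdom d" "x \<in> cdom e"
  shows "det (matrix (tder c e x)) = det (matrix (tder d e x)) * det (matrix (tder c d x))"
  using assms by (simp add: tder_compose[of c d e x] det_matrix_compose tder_linear)

lemma det_tder_nonzero:
  assumes "c \<in> M" "d \<in> M" "x \<in> cdom c" "x \<in> cdom d"
  shows "det (matrix (tder c d x)) \<noteq> 0"
  using det_tder_compose[of c d c x] tder_self[OF smooth_chartsD(1)[OF assms(1)] assms(3)] assms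
  by (auto simp: matrix_id_mat_1)

lemma jac_sign_cases:
  assumes "c \<in> M" "d \<in> M" "x \<in> cdom c" "x \<in> cdom d"
  shows "jac_sign c d x = 1 \<or> jac_sign c d x = -1"
  using det_tder_nonzero[OF assms] by (simp add: jac_sign_def sgn_real_def)

lemma jac_sign_compose:
  assumes "c \<in> M" "d \<in> M" "e \<in> M" "x \<in> cdom c" "x \<in> cdom d" "x \<in> cdom e"
  shows "jac_sign c e x = jac_sign c d x * jac_sign d e x"
  using det_tder_compose[OF assms] by (simp add: jac_sign_def sgn_mult)

lemma jac_sign_sym:
  assumes "c \<in> M" "d \<in> M" "x \<in> cdom c" "x \<in> cdom d"
  shows "jac_sign d c x = jac_sign c d x"
proof -
  have "jac_sign c d x * jac_sign d c x = 1"
    using jac_sign_compose[of c d c x] tder_self[OF smooth_chartsD(1)[OF assms(1)] assms(3)] assms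
    by (simp add: jac_sign_def[of c c] matrix_id_mat_1)
  then show ?thesis
    using jac_sign_cases[of c d x] jac_sign_cases[of d c x] assms by auto
qed

lemma jac_sign_locally_constant_aux:
  assumes c: "c \<in> M" and d: "d \<in> M" and "compatible c d" and x: "x \<in> cdom c" "x \<in> cdom d"
  obtains V where "open V" "x \<in> V" "V \<subseteq> cdom c \<inter> cdom d" "\<And>y. y \<in> V \<Longrightarrow> jac_sign c d y = jac_sign c d x"
proof -
  define f where "f y = det (matrix (tder c d y))" for y
  have opn: "open (cdom c \<inter> cdom d)"
    using c d by (simp add: chart_open_dom open_Int smooth_chartsD(1))
  have cont: "continuous_on (cdom c \<inter> cdom d) (\<lambda>y. tder c d y v)" for v
  proof -
    have "continuous_on (cmap c ` (cdom c \<inter> cdom d)) (\<lambda>y. frechet_derivative (transition c d) (at y) v)"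
      using \<open>compatible c d\<close> smooth_on_continuous_derivative unfolding compatible_def by blast
    moreover have "continuous_on (cdom c \<inter> cdom d) (cmap c)"
      using chart_continuous[OF smooth_chartsD(1)[OF c]] continuous_on_subset by blast
    ultimately show ?thesis
      unfolding tder_def using continuous_on_compose2 by blast
  qed
  have "continuous_on (cdom c \<inter> cdom d) f"
    unfolding f_def det_def matrix_def by (auto intro!: continuous_intros cont)
  moreover have "f x \<noteq> 0"
    unfolding f_def using det_tder_nonzero c d x by blast
  ultimately have "\<exists>V. open V \<and> x \<in> V \<and> V \<subseteq> cdom c \<inter> cdom d \<and> (\<forall>y\<in>V. sgn (f y) = sgn (f x))"
  proof (cases "f x > 0")
    case True
    let ?V = "(cdom c \<inter> cdom d) \<inter> f -` {0<..}"
    have "open ?V"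
      using \<open>continuous_on _ f\<close> opn by (intro continuous_open_preimage) auto
    then show ?thesis
      using True x by (intro exI[of _ ?V]) auto
  next
    case False
    let ?V = "(cdom c \<inter> cdom d) \<inter> f -` {..<0}"
    have "open ?V"
      using \<open>continuous_on _ f\<close> opn by (intro continuous_open_preimage) auto
    then show ?thesis
      using False \<open>f x \<noteq> 0\<close> x by (intro exI[of _ ?V]) auto
  qed
  then show ?thesis
    using that unfolding f_def jac_sign_def by blast
qed

lemma jac_sign_locally_constant:
  assumes c: "c \<in> M" and d: "d \<in> M" and x: "x \<in> cdom c" "x \<in> cdom d"
  obtains V where "open V" "x \<in> V" "V \<subseteq> cdom c \<inter> cdom d" "\<And>y. y \<in> V \<Longrightarrow> jac_sign c d y = jac_sign c d x"
proof -
  obtain a where a: "a \<in> A" "x \<in> cdom a" by (rule atlas_cover)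
  have aM: "a \<in> M" using a atlas_smooth_chart by blast
  have ca: "compatible c a" and ad: "compatible a d"
    using c d a compatible_sym smooth_chartsD by blast+
  obtain V where V: "open V" "x \<in> V" "V \<subseteq> cdom c \<inter> cdom a" "\<And>y. y \<in> V \<Longrightarrow> jac_sign c a y = jac_sign c a x"
    using jac_sign_locally_constant_aux[OF c aM ca x(1) a(2)] by blast
  obtain W where W: "open W" "x \<in> W" "W \<subseteq> cdom a \<inter> cdom d" "\<And>y. y \<in> W \<Longrightarrow> jac_sign a d y = jac_sign a d x"
    using jac_sign_locally_constant_aux[OF aM d ad a(2) x(2)] by blast
  show ?thesis
  proof (rule that)
    show "open (V \<inter> W)" "x \<in> V \<inter> W" "V \<inter> W \<subseteq> cdom c \<inter> cdom d"
      using V W by auto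
    show "jac_sign c d y = jac_sign c d x" if "y \<in> V \<inter> W" for y
    proof -
      have "y \<in> cdom c" "y \<in> cdom d" "y \<in> cdom a" using that V W by auto
      then show ?thesis
        using jac_sign_compose[of c a d] c d aM x a V(4) W(4) that by simp
    qed
  qed
qed

end

section \<open>Locally standard actions\<close>

lemma open_segment_near:
  fixes y v :: "'a::real_normed_vector"
  assumes "open U" "y \<in> U"
  obtains e where "e > 0" "\<And>t. \<bar>t\<bar> < e \<Longrightarrow> y + t *\<^sub>R v \<in> U"
proof -
  obtain r where r: "r > 0" "ball y r \<subseteq> U"
    using assms open_contains_ball by blast
  show ?thesis
  proof (rule that[of "r / (norm v + 1)"])
    show "r / (norm v + 1) > 0" using r by (simp add: add_nonneg_pos)
    show "y + t *\<^sub>R v \<in> U" if t: "\<bar>t\<bar> < r / (norm v + 1)" for t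
    proof -
      have pos: "norm v + 1 > 0" by (simp add: add_nonneg_pos)
      have "norm (t *\<^sub>R v) \<le> \<bar>t\<bar> * (norm v + 1)"
        by (simp add: mult_left_mono)
      also have "\<dots> < r"
        using t pos by (simp add: pos_less_divide_eq)
      finally have "y + t *\<^sub>R v \<in> ball y r" by (simp add: dist_norm)
      then show ?thesis using r by blast
    qed
  qed
qed

text \<open>A smooth manifold with a smooth and locally standard action.\<close>

locale standard_mfd = smooth_mfd A for A :: "('x::topological_space, 'n::finite) chart set" +
  fixes act :: "bit^'n \<Rightarrow> 'x \<Rightarrow> 'x"
  assumes action: "smooth_action A act" and standard: "locally_standard A act"
begin

text \<open>A standard chart together with the automorphism that it intertwines.\<close>

definition std :: "('x, 'n) chart \<Rightarrow> (bit^'n \<Rightarrow> bit^'n) \<Rightarrow> bool" where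
  "std c \<theta> \<longleftrightarrow> c \<in> M \<and> (\<forall>g. act g ` cdom c \<subseteq> cdom c) \<and> group_automorphism \<theta> \<and>
     (\<forall>g. \<forall>x\<in>cdom c. cmap c (act g x) = sign_action (\<theta> g) (cmap c x))"

lemma standard_chart_iff: "standard_chart A act c \<longleftrightarrow> (\<exists>\<theta>. std c \<theta>)"
  unfolding standard_chart_def std_def by blast

lemma std_exists: obtains c \<theta> where "std c \<theta>" "x \<in> cdom c"
  using standard standard_chart_iff unfolding locally_standard_def by blast

lemma stdD:
  assumes "std c \<theta>"
  shows "c \<in> M" "is_chart c" "group_automorphism \<theta>" "x \<in> cdom c \<Longrightarrow> act g x \<in> cdom c"
    "x \<in> cdom c \<Longrightarrow> cmap c (act g x) = sign_action (\<theta> g) (cmap c x)"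
  using assms smooth_chartsD(1) unfolding std_def by blast+

lemma act_zero [simp]: "act 0 x = x"
  using action by (simp add: smooth_action_def)

lemma act_add: "act (g + h) x = act g (act h x)"
  using action by (simp add: smooth_action_def)

lemma act_involution [simp]: "act g (act g x) = x"
  by (simp flip: act_add)

lemma act_continuous: "continuous_on S (act g)"
  using action unfolding smooth_action_def smooth_self_map_def
  by (meson continuous_on_subset subset_UNIV)

lemma std_fixed_iff:
  assumes c: "std c \<theta>" and x: "x \<in> cdom c"
  shows "act g x = x \<longleftrightarrow> (\<forall>i. \<theta> g $ i = 1 \<longrightarrow> cmap c x $ i = 0)"
proof -
  have "act g x = x \<longleftrightarrow> cmap c (act g x) = cmap c x"
    using chart_inj stdD[OF c] x by metis
  also have "\<dots> \<longleftrightarrow> (\<forall>i. bit_sign (\<theta> g $ i) * cmap c x $ i = cmap c x $ i)"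
    by (simp add: stdD(5)[OF c x] vec_eq_iff)
  also have "\<dots> \<longleftrightarrow> (\<forall>i. \<theta> g $ i = 1 \<longrightarrow> cmap c x $ i = 0)"
    by (auto simp: bit_sign_def)
  finally show ?thesis .
qed

lemma std_same_orbit:
  assumes c: "std c \<theta>" and x: "x \<in> cdom c" "y \<in> cdom c"
    and sq: "\<And>i. (cmap c x $ i)\<^sup>2 = (cmap c y $ i)\<^sup>2"
  obtains g where "y = act g x"
proof -
  define v :: "bit^'n" where "v = (\<chi> i. if cmap c x $ i = cmap c y $ i then 0 else 1)"
  have "cmap c (act (inv \<theta> v) x) = sign_action v (cmap c x)"
    using stdD(5)[OF c x(1)] automorphism_inv[OF stdD(3)[OF c]] by simp
  also have "\<dots> = cmap c y"
  proof -
    have "bit_sign (v $ i) * cmap c x $ i = cmap c y $ i" for i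
      using sq[of i] by (auto simp: v_def power2_eq_iff)
    then show ?thesis by (simp add: vec_eq_iff)
  qed
  finally show ?thesis
    using that chart_inj[OF stdD(2)[OF c]] stdD(4)[OF c x(1)] x(2) by blast
qed

text \<open>Changes of coordinates between standard charts are equivariant, and so are their
  derivatives.\<close>

lemma tder_equivariant:
  assumes c: "std c \<theta>" and d: "std d \<eta>" and x: "x \<in> cdom c" "x \<in> cdom d"
  shows "tder c d (act g x) \<circ> sign_action (\<theta> g) = sign_action (\<eta> g) \<circ> tder c d x"
proof -
  let ?y = "cmap c x" and ?S = "cmap c ` (cdom c \<inter> cdom d)"
  have gx: "act g x \<in> cdom c" "act g x \<in> cdom d"
    using c d x stdD by blast+
  have "(transition c d \<circ> sign_action (\<theta> g) has_derivative tder c d (act g x) \<circ> sign_action (\<theta> g)) (at ?y)"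
  proof (rule diff_chain_at[OF sign_action_has_derivative])
    show "(transition c d has_derivative tder c d (act g x)) (at (sign_action (\<theta> g) ?y))"
      using transition_has_derivative[of c d "act g x"] gx stdD(1)[OF c] stdD(1)[OF d] stdD(5)[OF c x(1)]
      by simp
  qed
  moreover have "(transition c d \<circ> sign_action (\<theta> g) has_derivative sign_action (\<eta> g) \<circ> tder c d x) (at ?y)"
  proof (rule has_derivative_transform_within_open)
    show "(sign_action (\<eta> g) \<circ> transition c d has_derivative sign_action (\<eta> g) \<circ> tder c d x) (at ?y)"
      using transition_has_derivative[of c d x] x stdD(1)[OF c] stdD(1)[OF d]
      by (intro diff_chain_at[OF _ sign_action_has_derivative]) simp
    show "open ?S"
      using stdD(2)[OF c] stdD(2)[OF d] by (intro chart_open_image) (auto simp: chart_open_dom open_Int)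
    show "?y \<in> ?S" using x by blast
    show "(sign_action (\<eta> g) \<circ> transition c d) y = (transition c d \<circ> sign_action (\<theta> g)) y" if y: "y \<in> ?S" for y
    proof -
      obtain z where z: "z \<in> cdom c" "z \<in> cdom d" "y = cmap c z" using y by blast
      have "transition c d (sign_action (\<theta> g) y) = transition c d (cmap c (act g z))"
        unfolding z(3) stdD(5)[OF c z(1)] ..
      also have "\<dots> = cmap d (act g z)"
        using z stdD(2,4)[OF c] by (simp add: transition_cmap)
      also have "\<dots> = sign_action (\<eta> g) (transition c d y)"
        using z stdD[OF c] stdD(5)[OF d] by (simp add: transition_cmap)
      finally show ?thesis by simp
    qed
  qed
  ultimately show ?thesis by (rule has_derivative_unique)
qed

lemma jac_sign_equivariant:
  assumes c: "std c \<theta>" and d: "std d \<eta>" and x: "x \<in> cdom c" "x \<in> cdom d"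
  shows "jac_sign c d (act g x) = total_sign (\<theta> g) * total_sign (\<eta> g) * jac_sign c d x"
proof -
  have gx: "act g x \<in> cdom c" "act g x \<in> cdom d"
    using c d x stdD by blast+
  have lin: "linear (tder c d (act g x))" "linear (tder c d x)"
    using tder_linear stdD(1) c d x gx by blast+
  have "det (matrix (tder c d (act g x) \<circ> sign_action (\<theta> g))) =
      det (matrix (sign_action (\<eta> g) \<circ> tder c d x))"
    by (simp add: tder_equivariant[OF assms])
  then have "det (matrix (tder c d (act g x))) * total_sign (\<theta> g) =
      total_sign (\<eta> g) * det (matrix (tder c d x))"
    by (simp add: det_matrix_compose lin linear_sign_action det_sign_action)
  moreover have "det (matrix (tder c d (act g x))) =
      det (matrix (tder c d (act g x))) * total_sign (\<theta> g) * total_sign (\<theta> g)"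
    by (simp add: mult.assoc)
  ultimately have "det (matrix (tder c d (act g x))) = total_sign (\<theta> g) * total_sign (\<eta> g) * det (matrix (tder c d x))"
    by (simp add: mult_ac)
  moreover have "sgn (total_sign h) = total_sign h" for h :: "bit^'n"
    using total_sign_cases[of h] by auto
  ultimately show ?thesis
    by (simp add: jac_sign_def sgn_mult)
qed

text \<open>At a fixed point, a standard chart diagonalizes the tangent representation.\<close>

lemma tangent_rep_std:
  assumes c: "std c \<theta>" and d: "d \<in> M" and x: "x \<in> cdom c" "x \<in> cdom d" and fixed: "act g x = x"
  shows "tangent_rep d act x g = tder c d x \<circ> sign_action (\<theta> g) \<circ> tder d c x"
proof -
  let ?S = "cmap d ` (cdom c \<inter> cdom d)"
  have cM: "c \<in> M" and isc: "is_chart c" and isd: "is_chart d"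
    using stdD[OF c] smooth_chartsD(1)[OF d] by auto
  have "(cmap d \<circ> act g \<circ> cinv d has_derivative tder c d x \<circ> sign_action (\<theta> g) \<circ> tder d c x) (at (cmap d x))"
  proof (rule has_derivative_transform_within_open)
    have y: "transition d c (cmap d x) = cmap c x" "sign_action (\<theta> g) (cmap c x) = cmap c x"
      using stdD(5)[OF c x(1), of g] fixed by (simp_all add: transition_cmap isd x)
    show "(transition c d \<circ> sign_action (\<theta> g) \<circ> transition d c has_derivative
        tder c d x \<circ> sign_action (\<theta> g) \<circ> tder d c x) (at (cmap d x))"
    proof (rule diff_chain_at[OF transition_has_derivative[OF d cM x(2,1)]])
      show "(transition c d \<circ> sign_action (\<theta> g) has_derivative tder c d x \<circ> sign_action (\<theta> g))
          (at (transition d c (cmap d x)))"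
        using transition_has_derivative[OF cM d x] y
        by (intro diff_chain_at[OF sign_action_has_derivative]) simp
    qed
    show "open ?S"
      using isc isd by (intro chart_open_image) (auto simp: chart_open_dom open_Int)
    show "cmap d x \<in> ?S" using x by blast
    show "(transition c d \<circ> sign_action (\<theta> g) \<circ> transition d c) y = (cmap d \<circ> act g \<circ> cinv d) y"
      if y: "y \<in> ?S" for y
    proof -
      obtain z where z: "z \<in> cdom c" "z \<in> cdom d" "y = cmap d z" using y by blast
      have "(transition c d \<circ> sign_action (\<theta> g) \<circ> transition d c) y = transition c d (cmap c (act g z))"
        using z stdD(5)[OF c] by (simp add: transition_cmap isd)
      also have "\<dots> = (cmap d \<circ> act g \<circ> cinv d) y"
        using z stdD(4)[OF c] by (simp add: transition_cmap isc chart_cinv_cmap isd)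
      finally show ?thesis .
    qed
  qed
  then show ?thesis
    unfolding tangent_rep_def using frechet_derivative_at by fastforce
qed

lemma tangent_rep_std_self:
  assumes c: "std c \<theta>" and x: "x \<in> cdom c" and "act g x = x"
  shows "tangent_rep c act x g = sign_action (\<theta> g)"
  using tangent_rep_std[OF c stdD(1)[OF c] x x assms(3)] tder_self[OF stdD(2)[OF c] x] by simp


section \<open>Reflections and their mirrors\<close>

text \<open>A reflection is an element that generates the stabilizer of some point. In a standard chart
  it changes the sign of exactly one coordinate, which vanishes at that point. Thus
  the reflections correspond to the characteristic vectors of the facets of the orbit polytope.\<close>

definition stab :: "'x \<Rightarrow> (bit^'n) set" where
  "stab x = {g. act g x = x}"

definition reflections :: "(bit^'n) set" where
  "reflections = {r. r \<noteq> 0 \<and> (\<exists>x. stab x = {0, r})}"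

text \<open>The mirror of a nonzero \<open>r\<close> is the set of points near which \<open>r\<close> acts as a reflection.\<close>

definition mirror :: "bit^'n \<Rightarrow> 'x set" where
  "mirror r = closure {x. stab x = {0, r}}"

lemma mirror_iff_nhds:
  "x \<in> mirror r \<longleftrightarrow> (\<forall>V. open V \<and> x \<in> V \<longrightarrow> (\<exists>z\<in>V. stab z = {0, r}))"
proof
  assume mir: "x \<in> mirror r"
  show "\<forall>V. open V \<and> x \<in> V \<longrightarrow> (\<exists>z\<in>V. stab z = {0, r})"
  proof (intro allI impI)
    fix V assume V: "open V \<and> x \<in> V"
    then have "V \<inter> {z. stab z = {0, r}} \<noteq> {}"
      using mir open_Int_closure_eq_empty[of V "{z. stab z = {0, r}}"] unfolding mirror_def by auto
    then show "\<exists>z\<in>V. stab z = {0, r}" by auto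
  qed
next
  assume *: "\<forall>V. open V \<and> x \<in> V \<longrightarrow> (\<exists>z\<in>V. stab z = {0, r})"
  have "open (- closure {z. stab z = {0, r}})" by (rule open_Compl[OF closed_closure])
  show "x \<in> mirror r"
  proof (rule ccontr)
    assume "x \<notin> mirror r"
    then obtain z where "z \<in> - closure {z. stab z = {0, r}}" "stab z = {0, r}"
      using * \<open>open (- closure {z. stab z = {0, r}})\<close> unfolding mirror_def by (metis ComplI)
    then show False using closure_subset[of "{z. stab z = {0, r}}"] by auto
  qed
qed

lemma stab_pair_std:
  assumes c: "std c \<theta>" and x: "x \<in> cdom c" and r: "r \<noteq> 0" and stab: "stab x = {0, r}"
  shows "\<exists>i. \<theta> r = axis i 1 \<and> cmap c x $ i = 0"
proof -
  note \<theta> = stdD(3)[OF c]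
  have "\<theta> r \<noteq> 0" using r \<theta> automorphism_eq_0_iff by blast
  then obtain i where i: "\<theta> r $ i = 1"
    by (auto simp: vec_eq_iff)
  have "act r x = x" using stab unfolding stab_def by blast
  then have xi: "cmap c x $ i = 0" using i std_fixed_iff[OF c x] by blast
  have "act (inv \<theta> (axis i 1)) x = x"
    unfolding std_fixed_iff[OF c x] automorphism_inv[OF \<theta>] using xi by (auto simp: axis_def)
  then have "inv \<theta> (axis i 1) \<in> {0, r}" using stab unfolding stab_def by blast
  moreover have "inv \<theta> (axis i 1) \<noteq> 0"
    using automorphism_inv[OF \<theta>, of "axis i 1"] automorphism_zero[OF \<theta>]
    by (auto simp: axis_eq_0_iff)
  ultimately show ?thesis
    using xi automorphism_inv[OF \<theta>, of "axis i 1"] by auto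
qed

lemma std_wall_mirror:
  assumes c: "std c \<theta>" and x: "x \<in> cdom c" and i: "cmap c x $ i = 0"
  shows "inv \<theta> (axis i 1) \<in> reflections" "x \<in> mirror (inv \<theta> (axis i 1))"
proof -
  note \<theta> = stdD(3)[OF c]
  let ?r = "inv \<theta> (axis i 1)"
  have r0: "?r \<noteq> 0"
    using automorphism_inv[OF \<theta>, of "axis i 1"] automorphism_zero[OF \<theta>]
    by (auto simp: axis_eq_0_iff)
  have ex: "\<exists>z\<in>V. stab z = {0, ?r}" if V: "open V" "x \<in> V" for V
  proof -
    let ?U = "cmap c ` (V \<inter> cdom c)"
    have "open ?U"
      using V stdD(2)[OF c] by (intro chart_open_image) (auto simp: chart_open_dom open_Int)
    moreover have "cmap c x \<in> ?U" using V x by blast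
    \<comment> \<open>Move all vanishing coordinates other than the i-th one away from zero.\<close>
    ultimately obtain e where e: "e > 0" "\<And>t. \<bar>t\<bar> < e \<Longrightarrow>
        cmap c x + t *\<^sub>R (\<chi> j. if j \<noteq> i \<and> cmap c x $ j = 0 then 1 else 0) \<in> ?U"
      using open_segment_near[where v = "\<chi> j. if j \<noteq> i \<and> cmap c x $ j = 0 then 1 else 0"] by blast
    have "cmap c x + (e/2) *\<^sub>R (\<chi> j. if j \<noteq> i \<and> cmap c x $ j = 0 then 1 else 0) \<in> ?U"
      using e(1) by (intro e(2)) simp
    then obtain z where z: "z \<in> V" "z \<in> cdom c" and
      zeq: "cmap c z = cmap c x + (e/2) *\<^sub>R (\<chi> j. if j \<noteq> i \<and> cmap c x $ j = 0 then 1 else 0)"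
      by auto
    have zero: "cmap c z $ j = 0 \<longleftrightarrow> j = i" for j
      using i e(1) by (auto simp: zeq)
    have "act g z = z \<longleftrightarrow> g = 0 \<or> g = ?r" for g
    proof
      assume "act g z = z"
      then have g: "\<And>j. j \<noteq> i \<Longrightarrow> \<theta> g $ j = 0"
        unfolding std_fixed_iff[OF c z(2)] zero by auto
      show "g = 0 \<or> g = ?r"
      proof (cases "\<theta> g $ i = 0")
        case True
        then have "\<theta> g = 0" using g by (metis vec_eq_iff zero_index)
        then show ?thesis using \<theta> automorphism_eq_0_iff by blast
      next
        case False
        then have "\<theta> g = axis i 1" using g by (auto simp: vec_eq_iff axis_def)
        then show ?thesis using automorphism_inv_inv[OF \<theta>, of g] by simp
      qed
    next
      assume "g = 0 \<or> g = ?r"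
      then show "act g z = z"
        unfolding std_fixed_iff[OF c z(2)] zero
        using automorphism_inv[OF \<theta>] \<theta> by (auto simp: axis_def split: if_splits)
    qed
    then have "stab z = {0, ?r}" unfolding stab_def by auto
    then show ?thesis using z by blast
  qed
  then show "?r \<in> reflections"
    using r0 open_UNIV unfolding reflections_def by blast
  show "x \<in> mirror ?r"
    unfolding mirror_iff_nhds using ex by blast
qed

lemma mirror_std_iff:
  assumes c: "std c \<theta>" and x: "x \<in> cdom c" and r: "r \<noteq> 0"
  shows "x \<in> mirror r \<longleftrightarrow> (\<exists>i. \<theta> r = axis i 1 \<and> cmap c x $ i = 0)"
proof
  assume "\<exists>i. \<theta> r = axis i 1 \<and> cmap c x $ i = 0"
  then obtain i where i: "\<theta> r = axis i 1" "cmap c x $ i = 0" by blast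
  then have "r = inv \<theta> (axis i 1)"
    using automorphism_inv_inv[OF stdD(3)[OF c], of r] by simp
  then show "x \<in> mirror r" using std_wall_mirror(2)[OF c x i(2)] by simp
next
  assume mir: "x \<in> mirror r"
  have near: "\<exists>z\<in>V. stab z = {0, r}" if "open V" "x \<in> V" for V
    using mir that unfolding mirror_iff_nhds by blast
  then obtain z where z: "z \<in> cdom c" "stab z = {0, r}"
    using near[OF chart_open_dom[OF stdD(2)[OF c]] x] by auto
  then obtain i where i: "\<theta> r = axis i 1"
    using stab_pair_std[OF c z(1) r z(2)] by blast
  have "cmap c x $ i = 0"
  proof (rule ccontr)
    assume "cmap c x $ i \<noteq> 0"
    have "open {y :: real^'n. y $ i \<noteq> 0}"
      by (intro open_Collect_neq continuous_intros)
    then have "open {w \<in> cdom c. cmap c w \<in> {y. y $ i \<noteq> 0}}"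
      using chart_open_vimage[OF stdD(2)[OF c]] by blast
    then obtain w where w: "w \<in> cdom c" "cmap c w $ i \<noteq> 0" "stab w = {0, r}"
      using near[of "{w \<in> cdom c. cmap c w \<in> {y. y $ i \<noteq> 0}}"] x \<open>cmap c x $ i \<noteq> 0\<close> by auto
    then obtain j where "\<theta> r = axis j 1" "cmap c w $ j = 0"
      using stab_pair_std[OF c w(1) r w(3)] by blast
    then show False using w(2) i by (simp add: axis_eq_axis)
  qed
  then show "\<exists>i. \<theta> r = axis i 1 \<and> cmap c x $ i = 0" using i by blast
qed

lemma reflection_mirror_nonempty: "r \<in> reflections \<Longrightarrow> mirror r \<noteq> {}"
  unfolding reflections_def mirror_def by auto

text \<open>A homomorphism is called reflective if its kernel contains no reflection.\<close>

definition reflective :: "(bit^'n \<Rightarrow> bit) \<Rightarrow> bool" where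
  "reflective \<epsilon> \<longleftrightarrow> additive \<epsilon> \<and> (\<forall>r\<in>reflections. \<epsilon> r = 1)"

lemma reflective_axis:
  "reflective \<epsilon> \<Longrightarrow> std c \<theta> \<Longrightarrow> x \<in> cdom c \<Longrightarrow> cmap c x $ i = 0 \<Longrightarrow> \<epsilon> (inv \<theta> (axis i 1)) = 1"
  unfolding reflective_def using std_wall_mirror(1) by blast

end

section \<open>Subgroups in general position and reflective homomorphisms\<close>

text \<open>The indicator of the complement of \<open>G\<close>. For a subgroup of index two it is the homomorphism
  with kernel \<open>G\<close>.\<close>

definition subgroup_char :: "(bit^'n) set \<Rightarrow> bit^'n \<Rightarrow> bit" where
  "subgroup_char G g = (if g \<in> G then 0 else 1)"

lemma index2_subgroup_char:
  assumes "index2_subgroup G"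
  shows "additive (subgroup_char G)" and "G \<noteq> UNIV"
proof -
  let ?C = "\<lambda>g. (\<lambda>h. g + h) ` G"
  have G: "0 \<in> G" "\<And>g h. g \<in> G \<Longrightarrow> h \<in> G \<Longrightarrow> g + h \<in> G" and card: "card (range ?C) = 2"
    using assms unfolding index2_subgroup_def by auto
  have mem: "k \<in> ?C g \<longleftrightarrow> g + k \<in> G" for g k
  proof
    assume "g + k \<in> G"
    moreover have "k = g + (g + k)" by simp
    ultimately show "k \<in> ?C g" by blast
  next
    assume "k \<in> ?C g"
    then show "g + k \<in> G" by auto
  qed
  have C0: "?C 0 = G" by simp
  show "G \<noteq> UNIV"
  proof
    assume "G = UNIV"
    then have "?C g = UNIV" for g using mem by auto
    then have "range ?C = {UNIV}" by auto
    then show False using card by simp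
  qed
  have sum: "g + h \<in> G" if "g \<notin> G" "h \<notin> G" for g h
  proof -
    have "?C g \<noteq> G" "?C h \<noteq> G"
      using that G(1) mem[of g g] mem[of h h] by auto
    have "?C g = ?C h"
    proof (rule ccontr)
      assume "?C g \<noteq> ?C h"
      then have "card {?C 0, ?C g, ?C h} = 3"
        unfolding C0 using \<open>?C g \<noteq> G\<close>[symmetric] \<open>?C h \<noteq> G\<close>[symmetric]
        by simp
      moreover have "card {?C 0, ?C g, ?C h} \<le> card (range ?C)"
      proof (rule card_mono)
        show "finite (range ?C)" using card by (intro card_ge_0_finite) simp
        show "{?C 0, ?C g, ?C h} \<subseteq> range ?C" by blast
      qed
      ultimately show False using card by simp
    qed
    then show ?thesis using mem[of h g] mem[of h h] G(1) mem[of g h] by auto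
  qed
  have mixed: "g + h \<notin> G" if "g \<in> G" "h \<notin> G" for g h
  proof
    assume "g + h \<in> G"
    then have "g + (g + h) \<in> G" using G that by blast
    then show False using that by simp
  qed
  show "additive (subgroup_char G)"
  proof (intro allI)
    fix g h
    show "subgroup_char G (g + h) = subgroup_char G g + subgroup_char G h"
      using G(2)[of g h] sum[of g h] mixed[of g h] mixed[of h g]
      by (auto simp: subgroup_char_def add.commute)
  qed
qed

lemma subgroup_char_kernel: "{g. subgroup_char G g = 0} = G"
  by (auto simp: subgroup_char_def)

lemma additive_kernel_index2:
  assumes \<epsilon>: "additive \<epsilon>" and r: "\<epsilon> r = 1"
  shows "index2_subgroup {g. \<epsilon> g = 0}"
proof -
  let ?G = "{g. \<epsilon> g = 0}"
  have coset: "(\<lambda>h. g + h) ` ?G = {k. \<epsilon> k = \<epsilon> g}" for g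
  proof
    show "(\<lambda>h. g + h) ` ?G \<subseteq> {k. \<epsilon> k = \<epsilon> g}" using \<epsilon> by auto
    show "{k. \<epsilon> k = \<epsilon> g} \<subseteq> (\<lambda>h. g + h) ` ?G"
    proof
      fix k assume "k \<in> {k. \<epsilon> k = \<epsilon> g}"
      then have "g + k \<in> ?G" using \<epsilon> by simp
      moreover have "k = g + (g + k)" by simp
      ultimately show "k \<in> (\<lambda>h. g + h) ` ?G" by blast
    qed
  qed
  have "range (\<lambda>g. (\<lambda>h. g + h) ` ?G) = {{k. \<epsilon> k = 0}, {k. \<epsilon> k = 1}}"
  proof -
    have "range (\<lambda>g. {k. \<epsilon> k = \<epsilon> g}) = (\<lambda>b. {k. \<epsilon> k = b}) ` range \<epsilon>" by auto
    moreover have "range \<epsilon> = {0, 1}"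
    proof
      show "range \<epsilon> \<subseteq> {0, 1}" using bit.exhaust by auto
      show "{0, 1} \<subseteq> range \<epsilon>"
        using r additive_zero[OF \<epsilon>] by (metis empty_subsetI insert_subset rangeI)
    qed
    ultimately show ?thesis by (simp add: coset)
  qed
  moreover have "{k. \<epsilon> k = 0} \<noteq> {k. \<epsilon> k = 1}"
    using additive_zero[OF \<epsilon>] by (auto simp: set_eq_iff)
  ultimately have "card (range (\<lambda>g. (\<lambda>h. g + h) ` ?G)) = 2" by simp
  then show ?thesis
    unfolding index2_subgroup_def using \<epsilon> additive_zero[OF \<epsilon>] by simp
qed

lemma card_UNIV_minus_one:
  fixes J :: "'n::finite set"
  assumes "card J = CARD('n) - 1"
  obtains k where "J = UNIV - {k}"
proof -
  have "card (UNIV - J) = CARD('n) - card J"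
    by (simp add: card_Diff_subset)
  also have "\<dots> = 1"
    using assms by (simp add: Suc_leI)
  finally obtain k where "UNIV - J = {k}" by (rule card_1_singletonE)
  then show ?thesis using that by blast
qed

text \<open>A nonvanishing determinant has a nonvanishing summand in its Leibniz expansion.\<close>

lemma basis_permutation:
  fixes B :: "'n::finite \<Rightarrow> real^'n"
  assumes "inj B" "independent (range B)"
  obtains p where "p permutes UNIV" "\<And>j. B j $ p j \<noteq> 0"
proof -
  let ?A = "(\<chi> i. B i) :: real^'n^'n"
  have "\<forall>c. (\<Sum>i\<in>UNIV. c i *s row i ?A) = 0 \<longrightarrow> (\<forall>i. c i = 0)"
  proof (intro allI impI)
    fix c i assume sum0: "(\<Sum>i\<in>UNIV. c i *s row i ?A) = 0"
    have "row i ?A = B i" for i by (simp add: row_def vec_eq_iff)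
    then have "(\<Sum>i\<in>UNIV. c i *\<^sub>R B i) = 0" using sum0 by (simp add: scalar_mult_eq_scaleR)
    moreover have "(\<Sum>v\<in>range B. c (inv B v) *\<^sub>R v) = (\<Sum>i\<in>UNIV. c i *\<^sub>R B i)"
      using \<open>inj B\<close> by (subst sum.reindex) (auto simp: inj_def intro!: sum.cong)
    ultimately have "\<forall>v\<in>range B. c (inv B v) = 0"
      using \<open>independent (range B)\<close> unfolding independent_explicit by auto
    then show "c i = 0" using \<open>inj B\<close> by auto
  qed
  then have "invertible ?A"
    unfolding invertible_right_inverse matrix_right_invertible_independent_rows .
  then have "det ?A \<noteq> 0" by (simp add: invertible_det_nz)
  then obtain p where "p \<in> {p. p permutes UNIV}" "of_int (sign p) * (\<Prod>i\<in>UNIV. ?A $ i $ p i) \<noteq> 0"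
    unfolding det_def by (rule sum.not_neutral_contains_not_neutral)
  then have "p permutes UNIV" "(\<Prod>i\<in>UNIV. ?A $ i $ p i) \<noteq> 0" by auto
  then show ?thesis using that by (auto simp: prod_zero_iff)
qed

context standard_mfd
begin

lemma weights_at_std:
  assumes c: "std c \<theta>" and x: "x \<in> cdom c" and fixed: "\<forall>g\<in>G. act g x = x"
  shows "weights_at A act G x (\<lambda>j g. \<theta> g $ j)"
  unfolding weights_at_def
proof (intro conjI bexI[of _ c] exI[of _ "\<lambda>j. axis j 1"])
  show "\<forall>j. \<forall>g\<in>G. \<forall>h\<in>G. \<theta> (g + h) $ j = \<theta> g $ j + \<theta> h $ j"
    by (simp add: automorphism_add[OF stdD(3)[OF c]])
  show "x \<in> cdom c" "c \<in> M" using x stdD(1)[OF c] by auto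
  show "inj (\<lambda>j. axis j (1::real))" by (simp add: inj_def axis_eq_axis)
  have "range (\<lambda>j. axis j (1::real)) = (Basis :: (real^'n) set)"
    by (auto simp: Basis_vec_def)
  then show "independent (range (\<lambda>j. axis j (1::real) :: real^'n))"
    by (simp add: independent_Basis)
  show "\<forall>j. \<forall>g\<in>G. tangent_rep c act x g (axis j 1) = bit_sign (\<theta> g $ j) *\<^sub>R axis j 1"
    using fixed by (auto simp: tangent_rep_std_self[OF c x] vec_eq_iff axis_def)
qed

text \<open>If all reflections lie outside an index two subgroup, then any two coordinate reflections have
  their product in the subgroup, and these products separate the weights.\<close>

lemma reflective_general_position:
  assumes refl: "reflective \<epsilon>"
  shows "general_position A act {g. \<epsilon> g = 0}"
  unfolding general_position_def
proof (intro allI impI)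
  fix x assume fixed: "\<forall>g\<in>{g. \<epsilon> g = 0}. act g x = x"
  obtain c \<theta> where c: "std c \<theta>" and x: "x \<in> cdom c" by (rule std_exists)
  note \<theta> = stdD(3)[OF c]
  have \<epsilon>: "additive \<epsilon>" using refl by (simp add: reflective_def)
  let ?r = "\<lambda>i. inv \<theta> (axis i 1)"
  have r1: "\<epsilon> (?r i) = 1" if "cmap c x $ i = 0" for i
    using reflective_axis[OF refl c x that] .
  have zero: "\<theta> g $ i = 1 \<Longrightarrow> \<epsilon> g = 0 \<Longrightarrow> cmap c x $ i = 0" for g i
    using fixed std_fixed_iff[OF c x] by blast
  have \<theta>r: "\<theta> (?r i) = axis i 1" for i by (rule automorphism_inv[OF \<theta>])
  have \<theta>r_nth: "\<theta> (?r i) $ j = (if j = i then 1 else 0)" for i j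
    unfolding \<theta>r by (simp add: axis_def)
  \<comment> \<open>A coordinate reflection in the kernel would fix \<open>x\<close> and hence be a reflection.\<close>
  have all1: "\<epsilon> (?r i) = 1" for i
  proof (rule ccontr)
    assume "\<epsilon> (?r i) \<noteq> 1"
    then show False using zero[of "?r i" i] r1[of i] \<theta>r_nth[of i i] by simp
  qed
  have "weights_independent {g. \<epsilon> g = 0} J (\<lambda>j g. \<theta> g $ j)" if J: "card J = CARD('n) - 1" for J
    unfolding weights_independent_def
  proof (intro allI impI ballI)
    fix a j
    assume sum0: "\<forall>g\<in>{g. \<epsilon> g = 0}. (\<Sum>j\<in>J. a j * \<theta> g $ j) = 0" and "j \<in> J"
    obtain k where k: "J = UNIV - {k}" using card_UNIV_minus_one[OF J] .
    then have "j \<noteq> k" using \<open>j \<in> J\<close> by blast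
    let ?g = "?r j + ?r k"
    have "\<epsilon> ?g = 0" using all1[of k] all1[of j] \<epsilon> by simp
    then have "(\<Sum>i\<in>J. a i * \<theta> ?g $ i) = 0" using sum0 by blast
    moreover have "a i * \<theta> ?g $ i = (if i = j then a j else 0)" if "i \<in> J" for i
      using that k by (auto simp: automorphism_add[OF \<theta>] \<theta>r_nth)
    ultimately show "a j = 0" using \<open>j \<in> J\<close> by (simp cong: sum.cong)
  qed
  then show "\<exists>\<alpha>. weights_at A act {g. \<epsilon> g = 0} x \<alpha> \<and>
      (\<forall>J. card J = CARD('n) - 1 \<longrightarrow> weights_independent {g. \<epsilon> g = 0} J \<alpha>)"
    using weights_at_std[OF c x fixed] by blast
qed

text \<open>The weights of \<open>G\<close> at a point that it fixes are, up to order, the coordinates of the automorphism of a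
  standard chart.\<close>

lemma weights_at_fixed_point:
  assumes c: "std c \<theta>" and x: "x \<in> cdom c" and fixed: "\<forall>g\<in>G. act g x = x"
    and w: "weights_at A act G x \<alpha>"
  obtains p where "p permutes (UNIV :: 'n set)" "\<And>j g. g \<in> G \<Longrightarrow> \<alpha> j g = \<theta> g $ p j"
proof -
  obtain d b where d: "d \<in> M" "x \<in> cdom d" and b: "inj b" "independent (range b)"
    and eig: "\<And>j g. g \<in> G \<Longrightarrow> tangent_rep d act x g (b j) = bit_sign (\<alpha> j g) *\<^sub>R b j"
    using w unfolding weights_at_def by blast
  note cM = stdD(1)[OF c]
  define D where "D = tder d c x"
  have lin: "linear D" unfolding D_def using tder_linear cM d x by blast
  have injD: "inj D"
    by (rule inj_on_inverseI[where g = "tder c d x"]) (simp add: D_def tder_inverse cM d x)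
  have eigD: "sign_action (\<theta> g) (D (b j)) = bit_sign (\<alpha> j g) *\<^sub>R D (b j)" if "g \<in> G" for g j
  proof -
    have "act g x = x" using fixed that by blast
    then have "tangent_rep d act x g (b j) = tder c d x (sign_action (\<theta> g) (D (b j)))"
      using tangent_rep_std[OF c d(1) x d(2), of g] by (simp add: D_def)
    then have "D (tangent_rep d act x g (b j)) = sign_action (\<theta> g) (D (b j))"
      by (simp add: D_def tder_inverse[OF cM d(1) x d(2)])
    then show ?thesis
      using eig[OF that] linear_cmul[OF lin] by simp
  qed
  have "inj (D \<circ> b)" using injD b(1) by (simp add: inj_compose)
  moreover have "independent (range (D \<circ> b))"
    unfolding image_comp[symmetric]
    by (rule linear_independent_injective_image[OF lin b(2)]) (use injD in \<open>auto simp: inj_on_def inj_def\<close>)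
  ultimately obtain p where p: "p permutes UNIV" "\<And>j. (D \<circ> b) j $ p j \<noteq> 0"
    using basis_permutation by blast
  have "\<alpha> j g = \<theta> g $ p j" if "g \<in> G" for j g
  proof -
    have "bit_sign (\<theta> g $ p j) * D (b j) $ p j = bit_sign (\<alpha> j g) * D (b j) $ p j"
      using arg_cong[OF eigD[OF that, of j], of "\<lambda>v. v $ p j"] by simp
    then show ?thesis using p(2)[of j] by simp
  qed
  then show ?thesis using that p(1) by blast
qed

text \<open>If a coordinate reflection lay in \<open>G\<close>, the relation among the weights that defines \<open>G\<close> would not
  involve the corresponding weight and would be a nontrivial relation among the others.\<close>

lemma general_position_no_reflection:
  assumes G: "two_subtorus_in_general_position A act G"
    and fixed: "\<And>g. act g x = x" and c: "std c \<theta>" and x: "x \<in> cdom c"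
  shows "inv \<theta> (axis i 1) \<notin> G"
proof
  assume ri: "inv \<theta> (axis i 1) \<in> G"
  have ind2: "index2_subgroup G" and gp: "general_position A act G"
    using G by (auto simp: two_subtorus_in_general_position_def)
  obtain \<alpha> where \<alpha>: "weights_at A act G x \<alpha>"
    and indep: "\<And>J. card J = CARD('n) - 1 \<Longrightarrow> weights_independent G J \<alpha>"
    using gp fixed unfolding general_position_def by blast
  obtain p where p: "p permutes (UNIV :: 'n set)" and weight: "\<And>j g. g \<in> G \<Longrightarrow> \<alpha> j g = \<theta> g $ p j"
    using weights_at_fixed_point[OF c x _ \<alpha>] fixed by blast
  define \<epsilon> where "\<epsilon> = subgroup_char G"
  define a where "a k = \<epsilon> (inv \<theta> (axis k 1))" for k
  have coord: "\<epsilon> g = (\<Sum>k\<in>UNIV. \<theta> g $ k * a k)" for g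
    unfolding a_def \<epsilon>_def by (rule additive_coordinates[OF index2_subgroup_char(1)[OF ind2] stdD(3)[OF c]])
  have ai: "a i = 0" using ri by (simp add: a_def \<epsilon>_def subgroup_char_def)
  define j0 where "j0 = inv p i"
  have pj0: "p j0 = i" using p by (simp add: j0_def permutes_inverses)
  have injp: "p j = p k \<longleftrightarrow> j = k" for j k using permutes_inj[OF p] by (auto simp: inj_def)
  let ?J = "UNIV - {j0}"
  have "(\<Sum>j\<in>?J. a (p j) * \<alpha> j g) = 0" if "g \<in> G" for g
  proof -
    have "(\<Sum>j\<in>?J. a (p j) * \<alpha> j g) = (\<Sum>j\<in>UNIV. a (p j) * \<theta> g $ p j)"
      using ai pj0 weight[OF that] by (subst sum.remove[of UNIV j0]) auto
    also have "\<dots> = (\<Sum>k\<in>UNIV. a k * \<theta> g $ k)"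
      using sum.permute[OF p, of "\<lambda>k. a k * \<theta> g $ k"] by (simp add: o_def)
    also have "\<dots> = \<epsilon> g" by (simp add: coord mult.commute)
    finally show ?thesis using that by (simp add: \<epsilon>_def subgroup_char_def)
  qed
  moreover have "weights_independent G ?J \<alpha>"
    by (rule indep) (simp add: card_Diff_subset)
  ultimately have "\<forall>j\<in>?J. a (p j) = 0"
    unfolding weights_independent_def by (elim allE[of _ "\<lambda>j. a (p j)"]) blast
  then have "a (p j) = 0" for j using ai pj0 by (cases "j = j0") auto
  then have "a k = 0" for k using permutes_surj[OF p] by (metis surjD)
  then have "\<epsilon> g = 0" for g by (simp add: coord)
  then show False
    using index2_subgroup_char(2)[OF ind2] subgroup_char_kernel[of G] by (auto simp: \<epsilon>_def)
qed

end

section \<open>The orbit polytope and its vertices\<close>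

text \<open>The directions in which a set extends both ways from a point. For a polyhedron this is the linear
  space that is parallel to the face whose relative interior contains the point.\<close>

definition lineality :: "(real^'n) set \<Rightarrow> real^'n \<Rightarrow> (real^'n) set" where
  "lineality P p = {w. \<exists>e>0. \<forall>t. \<bar>t\<bar> < e \<longrightarrow> p + t *\<^sub>R w \<in> P}"

lemma halfspace_representation:
  fixes P :: "(real^'n::finite) set"
  assumes "polyhedron P"
  obtains H where "finite H" "P = {x. \<forall>(a,b)\<in>H. a \<bullet> x \<le> b}"
proof -
  obtain F where F: "finite F" "P = \<Inter>F" "\<forall>h\<in>F. \<exists>a b. a \<noteq> 0 \<and> h = {x. a \<bullet> x \<le> b}"
    using assms unfolding polyhedron_def by blast
  then obtain a b where ab: "\<And>h. h \<in> F \<Longrightarrow> h = {x. a h \<bullet> x \<le> b h}" by metis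
  show ?thesis
  proof (rule that)
    show "finite ((\<lambda>h. (a h, b h)) ` F)" using F(1) by simp
    have "x \<in> P \<longleftrightarrow> (\<forall>h\<in>F. a h \<bullet> x \<le> b h)" for x
      unfolding F(2) Inter_iff using ab by blast
    then show "P = {x. \<forall>(a,b)\<in>(\<lambda>h. (a h, b h)) ` F. a \<bullet> x \<le> b}" by auto
  qed
qed

lemma lineality_halfspaces:
  fixes P :: "(real^'n::finite) set"
  assumes H: "finite H" "P = {x. \<forall>(a,b)\<in>H. a \<bullet> x \<le> b}" and p: "p \<in> P"
  shows "lineality P p = {w. \<forall>(a,b)\<in>H. a \<bullet> p = b \<longrightarrow> a \<bullet> w = 0}"
proof (intro set_eqI iffI)
  fix w assume "w \<in> lineality P p"
  then obtain e where e: "e > 0" "\<And>t. \<bar>t\<bar> < e \<Longrightarrow> p + t *\<^sub>R w \<in> P" unfolding lineality_def by blast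
  have "a \<bullet> w = 0" if "(a,b) \<in> H" "a \<bullet> p = b" for a b
  proof -
    have "p + (e/2) *\<^sub>R w \<in> P" "p + (-(e/2)) *\<^sub>R w \<in> P" using e(1) by (intro e(2); simp)+
    then have "a \<bullet> (p + (e/2) *\<^sub>R w) \<le> b" "a \<bullet> (p + (-(e/2)) *\<^sub>R w) \<le> b"
      using that(1) unfolding H(2) by blast+
    then have "(e/2) * (a \<bullet> w) \<le> 0" "(e/2) * (a \<bullet> w) \<ge> 0" using that(2) by (simp_all add: inner_simps)
    then have "(e/2) * (a \<bullet> w) = 0" by (rule antisym)
    then show ?thesis using e(1) by simp
  qed
  then show "w \<in> {w. \<forall>(a,b)\<in>H. a \<bullet> p = b \<longrightarrow> a \<bullet> w = 0}" by auto
next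
  fix w assume w: "w \<in> {w. \<forall>(a,b)\<in>H. a \<bullet> p = b \<longrightarrow> a \<bullet> w = 0}"
  have "\<exists>e>0. \<forall>t. \<bar>t\<bar> < e \<longrightarrow> a \<bullet> (p + t *\<^sub>R w) \<le> b" if ab: "(a,b) \<in> H" for a b
  proof (cases "a \<bullet> p = b")
    case True
    then have "a \<bullet> w = 0" using w ab by blast
    then show ?thesis using True by (intro exI[of _ 1]) (simp add: inner_simps)
  next
    case False
    then have "p \<in> {x. a \<bullet> x < b}" using p ab unfolding H(2) by fastforce
    then obtain e where "e > 0" "\<And>t. \<bar>t\<bar> < e \<Longrightarrow> p + t *\<^sub>R w \<in> {x. a \<bullet> x < b}"
      using open_segment_near[OF open_halfspace_lt] by blast
    then show ?thesis by (intro exI[of _ e]) (auto intro: less_imp_le)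
  qed
  then obtain e where e: "\<And>a b. (a,b) \<in> H \<Longrightarrow> e a b > 0 \<and> (\<forall>t. \<bar>t\<bar> < e a b \<longrightarrow> a \<bullet> (p + t *\<^sub>R w) \<le> b)"
    by metis
  define E where "E = (\<lambda>(a,b). e a b) ` H"
  define d where "d = Min (insert 1 E)"
  have fin: "finite (insert 1 E)" using H(1) by (simp add: E_def)
  have "d > 0" unfolding d_def using fin e by (subst Min_gr_iff) (auto simp: E_def)
  moreover have "p + t *\<^sub>R w \<in> P" if t: "\<bar>t\<bar> < d" for t
  proof -
    have "a \<bullet> (p + t *\<^sub>R w) \<le> b" if ab: "(a,b) \<in> H" for a b
    proof -
      have "d \<le> e a b" unfolding d_def using fin ab by (intro Min_le) (auto simp: E_def)
      then show ?thesis using e[OF ab] t by auto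
    qed
    then show ?thesis unfolding H(2) by blast
  qed
  ultimately show "w \<in> lineality P p" unfolding lineality_def by blast
qed

lemma lineality_constant:
  fixes P :: "(real^'n::finite) set"
  assumes "polyhedron P" "p \<in> P" and w: "w \<in> lineality P p"
  shows "\<exists>e>0. \<forall>t. \<bar>t\<bar> < e \<longrightarrow> lineality P (p + t *\<^sub>R w) = lineality P p"
proof -
  obtain H where H: "finite H" "P = {x. \<forall>(a,b)\<in>H. a \<bullet> x \<le> b}"
    using halfspace_representation[OF assms(1)] .
  obtain e where e: "e > 0" "\<And>t. \<bar>t\<bar> < e \<Longrightarrow> p + t *\<^sub>R w \<in> P" using w unfolding lineality_def by blast
  have act0: "a \<bullet> w = 0" if "(a,b) \<in> H" "a \<bullet> p = b" for a b
    using w that unfolding lineality_halfspaces[OF H assms(2)] by blast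
  \<comment> \<open>A constraint that is inactive at p but active inside the segment would be violated beyond it.\<close>
  have act: "a \<bullet> (p + t *\<^sub>R w) = b \<longleftrightarrow> a \<bullet> p = b" if ab: "(a,b) \<in> H" and t: "\<bar>t\<bar> < e" for a b t
  proof
    assume "a \<bullet> p = b"
    then show "a \<bullet> (p + t *\<^sub>R w) = b" using act0[OF ab] by (simp add: inner_simps)
  next
    assume eq: "a \<bullet> (p + t *\<^sub>R w) = b"
    have "p + t *\<^sub>R w \<in> P" by (rule e(2)[OF t])
    moreover have "w \<in> lineality P (p + t *\<^sub>R w)"
    proof -
      have "(p + t *\<^sub>R w) + s *\<^sub>R w \<in> P" if "\<bar>s\<bar> < e - \<bar>t\<bar>" for s
        using e(2)[of "t + s"] that by (simp add: algebra_simps)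
      then show ?thesis unfolding lineality_def using t by (intro CollectI exI[of _ "e - \<bar>t\<bar>"]) auto
    qed
    ultimately have "a \<bullet> w = 0" using lineality_halfspaces[OF H] eq ab by blast
    then show "a \<bullet> p = b" using eq by (simp add: inner_simps)
  qed
  have "lineality P (p + t *\<^sub>R w) = lineality P p" if t: "\<bar>t\<bar> < e" for t
    unfolding lineality_halfspaces[OF H e(2)[OF t]] lineality_halfspaces[OF H assms(2)]
    using act[OF _ t] by blast
  then show ?thesis using e(1) by blast
qed

text \<open>Coordinatewise squares.\<close>

definition vec_square :: "real^'n \<Rightarrow> real^'n" where
  "vec_square y = (\<chi> i. (y $ i)\<^sup>2)"

lemma vec_square_nth [simp]: "vec_square y $ i = (y $ i)\<^sup>2"
  by (simp add: vec_square_def)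

text \<open>A short segment that starts at the square of \<open>y\<close> and stays in the orthant lifts, by square roots
  with the signs of \<open>y\<close>, to points near \<open>y\<close>.\<close>

lemma vec_square_lift_segment:
  fixes y v :: "real^'n::finite"
  assumes U: "open U" "y \<in> U"
  obtains e where "e > 0"
    "\<And>t. \<bar>t\<bar> < e \<Longrightarrow> (\<And>i. y $ i = 0 \<Longrightarrow> t * v $ i \<ge> 0) \<Longrightarrow> \<exists>z\<in>U. vec_square z = vec_square y + t *\<^sub>R v"
proof -
  define \<psi> where "\<psi> t = (\<chi> i. (if y $ i < 0 then -1 else 1) * sqrt ((y $ i)\<^sup>2 + t * v $ i))" for t
  have \<psi>0: "\<psi> 0 = y" by (auto simp: \<psi>_def vec_eq_iff)
  have "((\<lambda>t. \<psi> t $ i) \<longlongrightarrow> (if y $ i < 0 then -1 else 1) * sqrt ((y $ i)\<^sup>2 + 0 * v $ i)) (nhds 0)" for i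
    unfolding \<psi>_def by (simp only: vec_lambda_beta) (intro tendsto_intros filterlim_ident)
  then have "(\<psi> \<longlongrightarrow> \<psi> 0) (nhds 0)"
    by (intro vec_tendstoI) (simp add: \<psi>_def)
  then have "(\<psi> \<longlongrightarrow> y) (nhds 0)" by (simp only: \<psi>0)
  then have ev1: "\<forall>\<^sub>F t in nhds 0. \<psi> t \<in> U" using U topological_tendstoD by blast
  have ev2: "\<forall>\<^sub>F t in nhds 0. \<forall>i. y $ i \<noteq> 0 \<longrightarrow> (y $ i)\<^sup>2 + t * v $ i > 0"
  proof (rule eventually_all_finite)
    fix i
    show "\<forall>\<^sub>F t in nhds 0. y $ i \<noteq> 0 \<longrightarrow> (y $ i)\<^sup>2 + t * v $ i > 0"
    proof (cases "y $ i = 0")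
      case False
      have "((\<lambda>t. (y $ i)\<^sup>2 + t * v $ i) \<longlongrightarrow> (y $ i)\<^sup>2 + 0 * v $ i) (nhds 0)"
        by (intro tendsto_intros filterlim_ident)
      then have "\<forall>\<^sub>F t in nhds 0. (y $ i)\<^sup>2 + t * v $ i > 0"
        by (rule order_tendstoD(1)) (use False in simp)
      then show ?thesis by (rule eventually_mono) simp
    qed simp
  qed
  obtain e where e: "e > 0" "\<And>t. \<bar>t\<bar> < e \<Longrightarrow> \<psi> t \<in> U \<and> (\<forall>i. y $ i \<noteq> 0 \<longrightarrow> (y $ i)\<^sup>2 + t * v $ i > 0)"
    using eventually_conj[OF ev1 ev2] unfolding eventually_nhds_metric by (auto simp: dist_real_def)
  show ?thesis
  proof (rule that[OF e(1)])
    fix t assume t: "\<bar>t\<bar> < e" and pos: "\<And>i. y $ i = 0 \<Longrightarrow> t * v $ i \<ge> 0"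
    have "vec_square (\<psi> t) $ i = (vec_square y + t *\<^sub>R v) $ i" for i
    proof -
      have "(y $ i)\<^sup>2 + t * v $ i \<ge> 0"
        using e(2)[OF t] pos[of i] by (cases "y $ i = 0") (auto intro: less_imp_le)
      then show ?thesis by (simp add: \<psi>_def power_mult_distrib)
    qed
    then show "\<exists>z\<in>U. vec_square z = vec_square y + t *\<^sub>R v"
      using e(2)[OF t] by (intro bexI[of _ "\<psi> t"]) (auto simp: vec_eq_iff)
  qed
qed

text \<open>The properties of a small cover that the argument uses, with a chosen diffeomorphism \<open>h\<close> from the
  orbit space to the polytope.\<close>

locale small_cover_mfd = standard_mfd A act for A :: "('x::topological_space, 'n::finite) chart set" and act +
  fixes P :: "(real^'n) set" and h :: "'x set \<Rightarrow> real^'n"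
  assumes compact_X: "compact (UNIV :: 'x set)" and connected_X: "connected (UNIV :: 'x set)"
    and polytope_P: "polytope P" and diffeo: "orbit_space_diffeo A act P h"
begin

text \<open>The orbit map to the polytope.\<close>

definition proj :: "'x \<Rightarrow> real^'n" where
  "proj x = h (orbit act x)"

lemma in_orbit_iff: "y \<in> orbit act x \<longleftrightarrow> (\<exists>g. y = act g x)"
  by (auto simp: orbit_def)

lemma orbit_act [simp]: "orbit act (act g x) = orbit act x"
proof (rule set_eqI)
  fix y
  have "(\<exists>k. y = act k (act g x)) \<longleftrightarrow> (\<exists>k. y = act k x)"
    by (metis act_add act_involution)
  then show "y \<in> orbit act (act g x) \<longleftrightarrow> y \<in> orbit act x"
    unfolding in_orbit_iff .
qed

lemma orbit_eqD: "orbit act x = orbit act y \<Longrightarrow> \<exists>g. y = act g x"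
proof -
  assume "orbit act x = orbit act y"
  moreover have "y \<in> orbit act y" unfolding in_orbit_iff by (metis act_zero)
  ultimately show ?thesis using in_orbit_iff by blast
qed

lemma proj_act [simp]: "proj (act g x) = proj x"
  by (simp add: proj_def)

lemma homeo: "homeomorphic_map (orbit_space act) (top_of_set P) h"
  using diffeo by (simp add: orbit_space_diffeo_def)

lemma h_image: "h ` range (orbit act) = P"
  using homeomorphic_imp_surjective_map[OF homeo] by (simp add: topspace_orbit_space)

lemma proj_image: "range proj = P"
  using h_image by (auto simp: proj_def)

lemma proj_in_P: "proj x \<in> P"
  using proj_image by blast

lemma h_inj: "inj_on h (range (orbit act))"
  using homeomorphic_imp_injective_map[OF homeo] by (simp add: topspace_orbit_space)

lemma proj_eqD: "proj x = proj y \<Longrightarrow> \<exists>g. y = act g x"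
  unfolding proj_def using h_inj orbit_eqD by (metis inj_onD rangeI)

lemma proj_continuous: "continuous_on UNIV proj"
  unfolding continuous_on_open_vimage[OF open_UNIV]
proof (intro allI impI)
  fix V :: "(real^'n) set" assume "open V"
  then have "openin (top_of_set P) (P \<inter> V)" by blast
  then have "openin (orbit_space act) {w \<in> topspace (orbit_space act). h w \<in> P \<inter> V}"
    using homeomorphic_imp_continuous_map[OF homeo] openin_continuous_map_preimage by blast
  then have "open (orbit act -` {w \<in> topspace (orbit_space act). h w \<in> P \<inter> V})"
    by (simp add: openin_orbit_space)
  also have "orbit act -` {w \<in> topspace (orbit_space act). h w \<in> P \<inter> V} = proj -` V \<inter> UNIV"
    using proj_in_P by (auto simp: topspace_orbit_space proj_def)
  finally show "open (proj -` V \<inter> UNIV)" .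
qed

lemma proj_open_image:
  assumes W: "open W" and inv: "\<And>g x. x \<in> W \<Longrightarrow> act g x \<in> W"
  shows "openin (top_of_set P) (proj ` W)"
proof -
  have "orbit act -` (orbit act ` W) = W"
    using orbit_eqD inv by blast
  then have "openin (orbit_space act) (orbit act ` W)"
    using W by (auto simp: openin_orbit_space)
  then have "openin (top_of_set P) (h ` orbit act ` W)"
    using homeomorphic_imp_open_map[OF homeo] by (simp add: open_map_def)
  then show ?thesis by (simp add: image_image proj_def[abs_def])
qed

text \<open>Over a segment in the polytope there are points in any invariant neighbourhood of a point over
  its centre.\<close>

lemma proj_segment_lift:
  assumes W: "open W" "\<And>g x. x \<in> W \<Longrightarrow> act g x \<in> W" and x: "x \<in> W" and w: "w \<in> lineality P (proj x)"
  obtains e where "e > 0" "\<And>t. \<bar>t\<bar> < e \<Longrightarrow> \<exists>z\<in>W. proj z = proj x + t *\<^sub>R w"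
proof -
  obtain e1 where e1: "e1 > 0" "\<And>t. \<bar>t\<bar> < e1 \<Longrightarrow> proj x + t *\<^sub>R w \<in> P"
    using w unfolding lineality_def by blast
  obtain T where T: "open T" "proj ` W = P \<inter> T"
    using proj_open_image[OF W] unfolding openin_open by blast
  have "proj x \<in> T" using T x by blast
  then obtain e2 where e2: "e2 > 0" "\<And>t. \<bar>t\<bar> < e2 \<Longrightarrow> proj x + t *\<^sub>R w \<in> T"
    using open_segment_near[OF T(1)] by blast
  show ?thesis
  proof (rule that[of "min e1 e2"])
    show "min e1 e2 > 0" using e1(1) e2(1) by simp
    show "\<exists>z\<in>W. proj z = proj x + t *\<^sub>R w" if "\<bar>t\<bar> < min e1 e2" for t
    proof -
      have "proj x + t *\<^sub>R w \<in> P \<inter> T" using e1(2)[of t] e2(2)[of t] that by simp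
      then show ?thesis using T(2) by (metis imageE)
    qed
  qed
qed

text \<open>A corner chart, written on the manifold: the map to the polytope is locally a smooth function of
  the squares of the coordinates, and conversely.\<close>

definition corner_chart :: "('x, 'n) chart \<Rightarrow> bool" where
  "corner_chart c \<longleftrightarrow> (\<forall>x\<in>cdom c.
     (\<exists>U F. open U \<and> vec_square (cmap c x) \<in> U \<and> smooth_on U F \<and>
        (\<forall>z\<in>cdom c. vec_square (cmap c z) \<in> U \<longrightarrow> F (vec_square (cmap c z)) = proj z)) \<and>
     (\<exists>U F. open U \<and> proj x \<in> U \<and> smooth_on U F \<and>
        (\<forall>z\<in>cdom c. proj z \<in> U \<longrightarrow> F (proj z) = vec_square (cmap c z))))"

lemma corner_chart_exists:
  obtains c \<theta> where "std c \<theta>" "x \<in> cdom c" "corner_chart c"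
proof -
  obtain c where x: "x \<in> cdom c" and c: "standard_chart A act c"
    and sm1: "ext_smooth_on (orbit_chart c ` orbit act ` cdom c)
      (h \<circ> the_inv_into (orbit act ` cdom c) (orbit_chart c))"
    and sm2: "ext_smooth_on (h ` orbit act ` cdom c)
      (orbit_chart c \<circ> the_inv_into (orbit act ` cdom c) h)"
    using diffeo unfolding orbit_space_diffeo_def Let_def by blast
  obtain \<theta> where std: "std c \<theta>" using c standard_chart_iff by blast
  have oc: "orbit_chart c (orbit act z) = vec_square (cmap c z)" if z: "z \<in> cdom c" for z
  proof -
    have "(SOME y. y \<in> orbit act z) \<in> orbit act z"
      by (rule someI[of _ z]) (metis act_zero in_orbit_iff)
    then obtain g where g: "(SOME y. y \<in> orbit act z) = act g z" using in_orbit_iff by blast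
    have "(bit_sign b * r)\<^sup>2 = r\<^sup>2" for b r
      by (simp add: bit_sign_def)
    then show ?thesis
      unfolding orbit_chart_def Let_def g by (simp add: stdD(5)[OF std z] vec_square_def)
  qed
  have inj1: "inj_on (orbit_chart c) (orbit act ` cdom c)"
  proof (rule inj_onI)
    fix u v assume "u \<in> orbit act ` cdom c" "v \<in> orbit act ` cdom c" and eq: "orbit_chart c u = orbit_chart c v"
    then obtain y z where yz: "y \<in> cdom c" "z \<in> cdom c" "u = orbit act y" "v = orbit act z" by blast
    then have "(cmap c y $ i)\<^sup>2 = (cmap c z $ i)\<^sup>2" for i
      using eq oc by (metis vec_square_nth)
    then obtain g where "z = act g y" using std_same_orbit[OF std yz(1,2)] by blast
    then show "u = v" using yz by simp
  qed
  have inj2: "inj_on h (orbit act ` cdom c)"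
    using h_inj by (rule inj_on_subset) blast
  have inv1: "the_inv_into (orbit act ` cdom c) (orbit_chart c) (vec_square (cmap c z)) = orbit act z"
    if "z \<in> cdom c" for z
    using the_inv_into_f_f[OF inj1, of "orbit act z"] oc[OF that] that by simp
  have inv2: "the_inv_into (orbit act ` cdom c) h (proj z) = orbit act z"
    if "z \<in> cdom c" for z
    using the_inv_into_f_f[OF inj2, of "orbit act z"] that by (simp add: proj_def)
  have "corner_chart c"
    unfolding corner_chart_def
  proof (intro ballI conjI)
    fix z assume z: "z \<in> cdom c"
    have "vec_square (cmap c z) \<in> orbit_chart c ` orbit act ` cdom c"
      using z oc by (metis imageI)
    then obtain U F where U: "open U" "vec_square (cmap c z) \<in> U" "smooth_on U F"
      "\<forall>y\<in>orbit_chart c ` orbit act ` cdom c \<inter> U. F y = (h \<circ> the_inv_into (orbit act ` cdom c) (orbit_chart c)) y"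
      using sm1 unfolding ext_smooth_on_def by blast
    have "F (vec_square (cmap c y)) = proj y" if "y \<in> cdom c" "vec_square (cmap c y) \<in> U" for y
    proof -
      have "vec_square (cmap c y) \<in> orbit_chart c ` orbit act ` cdom c \<inter> U"
        using that oc by (metis IntI imageI)
      then show ?thesis using U(4) inv1[OF that(1)] by (simp add: proj_def)
    qed
    then show "\<exists>U F. open U \<and> vec_square (cmap c z) \<in> U \<and> smooth_on U F \<and>
        (\<forall>z\<in>cdom c. vec_square (cmap c z) \<in> U \<longrightarrow> F (vec_square (cmap c z)) = proj z)"
      using U by blast
  next
    fix z assume z: "z \<in> cdom c"
    have "proj z \<in> h ` orbit act ` cdom c" using z by (simp add: proj_def)
    then obtain U F where U: "open U" "proj z \<in> U" "smooth_on U F"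
      "\<forall>y\<in>h ` orbit act ` cdom c \<inter> U. F y = (orbit_chart c \<circ> the_inv_into (orbit act ` cdom c) h) y"
      using sm2 unfolding ext_smooth_on_def by blast
    have "F (proj y) = vec_square (cmap c y)" if "y \<in> cdom c" "proj y \<in> U" for y
    proof -
      have "proj y \<in> h ` orbit act ` cdom c \<inter> U" using that by (simp add: proj_def)
      then show ?thesis using U(4) inv2[OF that(1)] oc[OF that(1)] by simp
    qed
    then show "\<exists>U F. open U \<and> proj z \<in> U \<and> smooth_on U F \<and>
        (\<forall>y\<in>cdom c. proj y \<in> U \<longrightarrow> F (proj y) = vec_square (cmap c y))"
      using U by blast
  qed
  then show ?thesis using that[OF std x] by blast
qed

text \<open>The space of directions in which the coordinates vanishing at \<open>x\<close> stay zero.\<close>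

definition stratum_space :: "('x, 'n) chart \<Rightarrow> 'x \<Rightarrow> (real^'n) set" where
  "stratum_space c x = {v. \<forall>i. cmap c x $ i = 0 \<longrightarrow> v $ i = 0}"

lemma polyhedron_P: "polyhedron P"
  by (simp add: polytope_P polytope_imp_polyhedron)

text \<open>The orbit map carries the stratum of the corner structure through \<open>x\<close> to the face of the polytope
  whose relative interior contains the image of \<open>x\<close>, infinitesimally.\<close>

lemma corner_chart_lineality:
  assumes c: "std c \<theta>" "corner_chart c" and x: "x \<in> cdom c"
  obtains D where "linear D" "inj D" "D ` stratum_space c x = lineality P (proj x)"
proof -
  let ?q = "vec_square (cmap c x)" and ?p = "proj x"
  obtain U F where U: "open U" "?q \<in> U" "smooth_on U F"
    and F: "\<And>z. z \<in> cdom c \<Longrightarrow> vec_square (cmap c z) \<in> U \<Longrightarrow> F (vec_square (cmap c z)) = proj z"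
    using c(2) x unfolding corner_chart_def by meson
  obtain U' F' where U': "open U'" "?p \<in> U'" "smooth_on U' F'"
    and F': "\<And>z. z \<in> cdom c \<Longrightarrow> proj z \<in> U' \<Longrightarrow> F' (proj z) = vec_square (cmap c z)"
    using c(2) x unfolding corner_chart_def by meson
  define D where "D = frechet_derivative F (at ?q)"
  define D' where "D' = frechet_derivative F' (at ?p)"
  have D: "(F has_derivative D) (at ?q)" unfolding D_def using smooth_on_has_derivative[OF U(3,2)] .
  have D': "(F' has_derivative D') (at ?p)" unfolding D'_def using smooth_on_has_derivative[OF U'(3,2)] .
  have lin: "linear D" "linear D'" using D D' has_derivative_linear by blast+
  have Fq: "F ?q = ?p" using F[OF x U(2)] .
  have opn: "open (cmap c ` cdom c)" using stdD(2)[OF c(1)] by (simp add: is_chart_def)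
  have inv: "\<And>g z. z \<in> cdom c \<Longrightarrow> act g z \<in> cdom c" using stdD(4)[OF c(1)] .

  have seg: "\<exists>e>0. \<forall>t. \<bar>t\<bar> < e \<longrightarrow> (\<forall>i. cmap c x $ i = 0 \<longrightarrow> t * v $ i \<ge> 0) \<longrightarrow>
      (\<exists>z\<in>cdom c. vec_square (cmap c z) = ?q + t *\<^sub>R v \<and> ?q + t *\<^sub>R v \<in> U)" for v
  proof -
    obtain e1 where e1: "e1 > 0" "\<And>t. \<bar>t\<bar> < e1 \<Longrightarrow> (\<And>i. cmap c x $ i = 0 \<Longrightarrow> t * v $ i \<ge> 0) \<Longrightarrow>
        \<exists>z\<in>cmap c ` cdom c. vec_square z = ?q + t *\<^sub>R v"
      using vec_square_lift_segment[OF opn imageI[OF x], of v] by blast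
    obtain e2 where e2: "e2 > 0" "\<And>t. \<bar>t\<bar> < e2 \<Longrightarrow> ?q + t *\<^sub>R v \<in> U"
      using open_segment_near[OF U(1,2)] by blast
    show ?thesis
    proof (intro exI[of _ "min e1 e2"] conjI allI impI)
      show "min e1 e2 > 0" using e1(1) e2(1) by simp
      fix t assume t: "\<bar>t\<bar> < min e1 e2" "\<forall>i. cmap c x $ i = 0 \<longrightarrow> t * v $ i \<ge> 0"
      then show "\<exists>z\<in>cdom c. vec_square (cmap c z) = ?q + t *\<^sub>R v \<and> ?q + t *\<^sub>R v \<in> U"
        using e1(2)[of t] e2(2)[of t] by auto
    qed
  qed
  have line_deriv: "((\<lambda>t. q + t *\<^sub>R v) has_derivative (\<lambda>t. t *\<^sub>R v)) (at t within S)" for q v :: "real^'n" and t S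
    by (auto intro!: derivative_eq_intros)
  have F_line: "((\<lambda>t. F (?q + t *\<^sub>R v)) has_derivative (\<lambda>t. D (t *\<^sub>R v))) (at 0)" for v
    using diff_chain_at[OF line_deriv[of ?q v 0 UNIV], of F D] D by (simp add: o_def)
  have F'_line: "((\<lambda>t. F' (?p + t *\<^sub>R v)) has_derivative (\<lambda>t. D' (t *\<^sub>R v))) (at 0)" for v
    using diff_chain_at[OF line_deriv[of ?p v 0 UNIV], of F' D'] D' by (simp add: o_def)

  \<comment> \<open>The segment in a coordinate direction may lie in the orthant only for nonnegative parameters, so
    one-sided derivatives have to be compared.\<close>
  have D'D_axis: "D' (D (axis i 1)) = axis i 1" for i
  proof -
    let ?v = "axis i 1 :: real^'n"
    obtain e where e: "e > 0" "\<And>t. \<bar>t\<bar> < e \<Longrightarrow> (\<forall>i. cmap c x $ i = 0 \<longrightarrow> t * ?v $ i \<ge> 0) \<Longrightarrow>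
        \<exists>z\<in>cdom c. vec_square (cmap c z) = ?q + t *\<^sub>R ?v \<and> ?q + t *\<^sub>R ?v \<in> U"
      using seg[of ?v] by blast
    have "isCont (\<lambda>t. F (?q + t *\<^sub>R ?v)) 0"
      using has_derivative_continuous[OF F_line] .
    then have "((\<lambda>t. F (?q + t *\<^sub>R ?v)) \<longlongrightarrow> ?p) (nhds 0)"
      using Fq unfolding continuous_at by (metis (no_types, lifting) add.right_neutral scaleR_zero_left tendsto_at_iff_tendsto_nhds)
    then have "\<forall>\<^sub>F t in nhds 0. F (?q + t *\<^sub>R ?v) \<in> U'"
      using U' topological_tendstoD by blast
    then obtain d where d: "d > 0" "\<And>t. \<bar>t\<bar> < d \<Longrightarrow> F (?q + t *\<^sub>R ?v) \<in> U'"
      unfolding eventually_nhds_metric by (auto simp: dist_real_def)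
    define b where "b = min d e / 2"
    have b: "b > 0" "b < d" "b < e" using d(1) e(1) by (auto simp: b_def min_def)
    have eq: "F' (F (?q + t *\<^sub>R ?v)) = ?q + t *\<^sub>R ?v" if t: "t \<in> {0..b}" for t
    proof -
      have "\<bar>t\<bar> < e" "\<bar>t\<bar> < d" using t b by auto
      moreover have "\<forall>i. cmap c x $ i = 0 \<longrightarrow> t * ?v $ i \<ge> 0" using t by (auto simp: axis_def)
      ultimately obtain z where z: "z \<in> cdom c" "vec_square (cmap c z) = ?q + t *\<^sub>R ?v" "?q + t *\<^sub>R ?v \<in> U"
        using e(2)[of t] by blast
      have "F (?q + t *\<^sub>R ?v) = proj z" using F[OF z(1)] z(2,3) by simp
      then show ?thesis using F'[OF z(1)] d(2)[OF \<open>\<bar>t\<bar> < d\<close>] z(2) by simp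
    qed
    have "((\<lambda>t. F' (F (?q + t *\<^sub>R ?v))) has_derivative (\<lambda>t. D' (D (t *\<^sub>R ?v)))) (at 0)"
      using diff_chain_at[OF F_line[of ?v], of F' D'] D' Fq by (simp add: o_def)
    then have "((\<lambda>t. F' (F (?q + t *\<^sub>R ?v))) has_derivative (\<lambda>t. D' (D (t *\<^sub>R ?v)))) (at 0 within {0..b})"
      by (rule has_derivative_at_withinI)
    then have "((\<lambda>t. ?q + t *\<^sub>R ?v) has_derivative (\<lambda>t. D' (D (t *\<^sub>R ?v)))) (at 0 within {0..b})"
      by (rule has_derivative_transform_within[where d = 1]) (use b eq in auto)
    then have "((\<lambda>t. ?q + t *\<^sub>R ?v) has_vector_derivative D' (D ?v)) (at 0 within {0..b})"
      by (simp add: has_vector_derivative_def linear_cmul[OF lin(1)] linear_cmul[OF lin(2)])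
    moreover have "((\<lambda>t. ?q + t *\<^sub>R ?v) has_vector_derivative ?v) (at 0 within {0..b})"
      unfolding has_vector_derivative_def by (rule line_deriv)
    moreover have "at (0::real) within {0..b} \<noteq> bot"
      using b(1) by (simp add: trivial_limit_within islimpt_Icc)
    ultimately show ?thesis by (metis vector_derivative_unique_within)
  qed
  have "D' \<circ> D = id"
  proof (rule linear_eq_stdbasis)
    show "linear (D' \<circ> D)" using lin linear_compose by blast
    show "linear (id :: real^'n \<Rightarrow> real^'n)" by (rule linear_id)
    show "(D' \<circ> D) b = id b" if "b \<in> Basis" for b :: "real^'n"
      using that D'D_axis by (auto simp: Basis_vec_def)
  qed
  then have DD': "D \<circ> D' = id" using linear_inverse_left[OF lin] by blast
  have injD: "inj D" using \<open>D' \<circ> D = id\<close> by (metis inj_on_id inj_on_imageI2)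
  obtain H where H: "finite H" "P = {y. \<forall>(a,b)\<in>H. a \<bullet> y \<le> b}"
    using halfspace_representation[OF polyhedron_P] .

  \<comment> \<open>Along the stratum, an active constraint of the polytope attains its maximum at the given point.\<close>
  have "D v \<in> lineality P ?p" if v: "v \<in> stratum_space c x" for v
  proof -
    have "a \<bullet> D v = 0" if ab: "(a,b) \<in> H" "a \<bullet> ?p = b" for a b
    proof -
      obtain e where e: "e > 0" "\<And>t. \<bar>t\<bar> < e \<Longrightarrow> (\<forall>i. cmap c x $ i = 0 \<longrightarrow> t * v $ i \<ge> 0) \<Longrightarrow>
          \<exists>z\<in>cdom c. vec_square (cmap c z) = ?q + t *\<^sub>R v \<and> ?q + t *\<^sub>R v \<in> U"
        using seg[of v] by blast
      have "((\<lambda>t. a \<bullet> F (?q + t *\<^sub>R v)) has_derivative (\<lambda>t. a \<bullet> D (t *\<^sub>R v))) (at 0)"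
        by (rule has_derivative_inner_right[OF F_line])
      then have "DERIV (\<lambda>t. a \<bullet> F (?q + t *\<^sub>R v)) 0 :> a \<bullet> D v"
        by (simp add: has_field_derivative_def linear_cmul[OF lin(1)] mult_commute_abs)
      moreover have "\<forall>t. \<bar>0 - t\<bar> < e \<longrightarrow> a \<bullet> F (?q + t *\<^sub>R v) \<le> a \<bullet> F (?q + 0 *\<^sub>R v)"
      proof (intro allI impI)
        fix t assume "\<bar>0 - t\<bar> < e"
        moreover have "\<forall>i. cmap c x $ i = 0 \<longrightarrow> t * v $ i \<ge> 0" using v by (simp add: stratum_space_def)
        ultimately obtain z where z: "z \<in> cdom c" "vec_square (cmap c z) = ?q + t *\<^sub>R v" "?q + t *\<^sub>R v \<in> U"
          using e(2)[of t] by auto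
        then have "F (?q + t *\<^sub>R v) \<in> P" using F[OF z(1)] proj_in_P[of z] by simp
        then show "a \<bullet> F (?q + t *\<^sub>R v) \<le> a \<bullet> F (?q + 0 *\<^sub>R v)"
          using ab Fq unfolding H(2) by auto
      qed
      ultimately show ?thesis using e(1) by (intro DERIV_local_max)
    qed
    then show ?thesis unfolding lineality_halfspaces[OF H proj_in_P] by blast
  qed
  \<comment> \<open>Along the segment in the polytope, a vanishing squared coordinate attains its minimum.\<close>
  moreover have "D' w \<in> stratum_space c x" if w: "w \<in> lineality P ?p" for w
    unfolding stratum_space_def
  proof (intro CollectI allI impI)
    fix i assume i: "cmap c x $ i = 0"
    obtain e1 where e1: "e1 > 0" "\<And>t. \<bar>t\<bar> < e1 \<Longrightarrow> \<exists>z\<in>cdom c. proj z = ?p + t *\<^sub>R w"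
      using proj_segment_lift[OF chart_open_dom[OF stdD(2)[OF c(1)]] inv x w] by blast
    obtain e2 where e2: "e2 > 0" "\<And>t. \<bar>t\<bar> < e2 \<Longrightarrow> ?p + t *\<^sub>R w \<in> U'"
      using open_segment_near[OF U'(1,2)] by blast
    have "((\<lambda>t. F' (?p + t *\<^sub>R w) $ i) has_derivative (\<lambda>t. D' (t *\<^sub>R w) $ i)) (at 0)"
      by (rule bounded_linear.has_derivative[OF bounded_linear_vec_nth F'_line])
    then have "DERIV (\<lambda>t. F' (?p + t *\<^sub>R w) $ i) 0 :> D' w $ i"
      by (simp add: has_field_derivative_def linear_cmul[OF lin(2)] mult_commute_abs)
    moreover have "\<forall>t. \<bar>0 - t\<bar> < min e1 e2 \<longrightarrow> F' (?p + 0 *\<^sub>R w) $ i \<le> F' (?p + t *\<^sub>R w) $ i"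
    proof (intro allI impI)
      fix t assume t: "\<bar>0 - t\<bar> < min e1 e2"
      then obtain z where z: "z \<in> cdom c" "proj z = ?p + t *\<^sub>R w" using e1(2)[of t] by auto
      have "F' (?p + t *\<^sub>R w) = vec_square (cmap c z)" using F'[OF z(1)] z(2) e2(2)[of t] t by simp
      moreover have "F' (?p + 0 *\<^sub>R w) = ?q" using F'[OF x U'(2)] by simp
      ultimately show "F' (?p + 0 *\<^sub>R w) $ i \<le> F' (?p + t *\<^sub>R w) $ i" using i by simp
    qed
    ultimately show "D' w $ i = 0" using e1(1) e2(1) by (intro DERIV_local_min[where d = "min e1 e2"]) auto
  qed
  ultimately have "D ` stratum_space c x = lineality P ?p"
    using DD' by (metis (no_types, lifting) comp_apply id_apply image_iff subsetI subset_antisym image_subsetI)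
  then show ?thesis using that lin(1) injD by blast
qed

lemma stratum_space_subspace: "subspace (stratum_space c x)"
  unfolding subspace_def stratum_space_def by auto

text \<open>A closed union of strata contains a point fixed by the whole group: a point of it that is
  mapped furthest from the origin lies over a vertex, since otherwise a segment in the face
  through its image would reach further out.\<close>

lemma global_fixed_point:
  assumes S: "closed S" "S \<noteq> {}"
    and strata: "\<And>c \<theta> x z. std c \<theta> \<Longrightarrow> x \<in> S \<Longrightarrow> x \<in> cdom c \<Longrightarrow> z \<in> cdom c \<Longrightarrow>
      (\<And>i. cmap c z $ i = 0 \<longleftrightarrow> cmap c x $ i = 0) \<Longrightarrow> z \<in> S"
  obtains x where "x \<in> S" "\<forall>g. act g x = x"
proof -
  have "compact S" using compact_Int_closed[OF compact_X S(1)] by simp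
  moreover have "continuous_on S (\<lambda>x. norm (proj x))"
    using proj_continuous by (intro continuous_on_norm) (meson continuous_on_subset subset_UNIV)
  ultimately obtain x where x: "x \<in> S" "\<And>z. z \<in> S \<Longrightarrow> norm (proj z) \<le> norm (proj x)"
    using continuous_attains_sup[OF _ S(2)] by blast
  obtain c \<theta> where c: "std c \<theta>" "x \<in> cdom c" "corner_chart c" by (rule corner_chart_exists)
  have "cmap c x $ k = 0" for k
  proof (rule ccontr)
    assume k: "cmap c x $ k \<noteq> 0"
    obtain D where D: "linear D" "inj D" "D ` stratum_space c x = lineality P (proj x)"
      using corner_chart_lineality[OF c(1,3,2)] .
    define w where "w = D (axis k 1)"
    have "axis k 1 \<in> stratum_space c x" using k by (auto simp: stratum_space_def axis_def)
    then have w: "w \<in> lineality P (proj x)" unfolding w_def using D(3) by blast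
    have "w \<noteq> 0"
    proof
      assume "w = 0"
      then have "D (axis k 1) = D 0" using linear_0[OF D(1)] by (simp add: w_def)
      then show False using D(2) by (metis axis_eq_0_iff injD zero_neq_one)
    qed
    \<comment> \<open>Near \<open>x\<close> no further coordinate vanishes; equality of the dimensions then forces the same
      coordinates to vanish along the lifted segment.\<close>
    define W where "W = {z \<in> cdom c. cmap c z \<in> {y. \<forall>i. cmap c x $ i \<noteq> 0 \<longrightarrow> y $ i \<noteq> 0}}"
    have "open {y :: real^'n. \<forall>i. cmap c x $ i \<noteq> 0 \<longrightarrow> y $ i \<noteq> 0}"
    proof -
      have "open (\<Inter>i\<in>{i. cmap c x $ i \<noteq> 0}. {y :: real^'n. y $ i \<noteq> 0})"
        by (intro open_INT ballI open_Collect_neq continuous_intros) auto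
      also have "(\<Inter>i\<in>{i. cmap c x $ i \<noteq> 0}. {y :: real^'n. y $ i \<noteq> 0})
          = {y. \<forall>i. cmap c x $ i \<noteq> 0 \<longrightarrow> y $ i \<noteq> 0}" by auto
      finally show ?thesis .
    qed
    then have "open W" unfolding W_def using chart_open_vimage[OF stdD(2)[OF c(1)]] by blast
    have Winv: "act g z \<in> W" if "z \<in> W" for g z
      using that stdD(4,5)[OF c(1)] by (auto simp: W_def)
    have "x \<in> W" using c by (auto simp: W_def)
    obtain e1 where e1: "e1 > 0" "\<And>t. \<bar>t\<bar> < e1 \<Longrightarrow> \<exists>z\<in>W. proj z = proj x + t *\<^sub>R w"
      using proj_segment_lift[OF \<open>open W\<close> Winv \<open>x \<in> W\<close> w] by blast
    obtain e2 where e2: "e2 > 0"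
      "\<forall>t. \<bar>t\<bar> < e2 \<longrightarrow> lineality P (proj x + t *\<^sub>R w) = lineality P (proj x)"
      using lineality_constant[OF polyhedron_P proj_in_P w] by auto
    have bound: "norm (proj x + t *\<^sub>R w) \<le> norm (proj x)" if t: "\<bar>t\<bar> < min e1 e2" for t
    proof -
      obtain z where z: "z \<in> W" "proj z = proj x + t *\<^sub>R w" using e1(2)[of t] t by auto
      have zc: "z \<in> cdom c" and zsub: "\<And>i. cmap c x $ i \<noteq> 0 \<Longrightarrow> cmap c z $ i \<noteq> 0" using z(1) by (auto simp: W_def)
      obtain D1 where D1: "linear D1" "inj D1" "D1 ` stratum_space c z = lineality P (proj z)"
        using corner_chart_lineality[OF c(1,3) zc] .
      have "dim (stratum_space c z) = dim (lineality P (proj z))"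
        using dim_image_eq[OF D1(1), of "stratum_space c z"] D1(2,3) by (simp add: inj_on_def inj_def)
      also have "\<dots> = dim (lineality P (proj x))" using e2(2) t z(2) by simp
      also have "\<dots> = dim (stratum_space c x)"
        using dim_image_eq[OF D(1), of "stratum_space c x"] D(2,3) by (simp add: inj_on_def inj_def)
      finally have "dim (stratum_space c z) = dim (stratum_space c x)" .
      moreover have "stratum_space c x \<subseteq> stratum_space c z" using zsub by (auto simp: stratum_space_def)
      ultimately have eq: "stratum_space c x = stratum_space c z"
        using subspace_dim_equal[OF stratum_space_subspace stratum_space_subspace] by simp
      have "cmap c z $ i = 0 \<longleftrightarrow> cmap c x $ i = 0" for i
      proof -
        have "axis i 1 \<in> stratum_space c y \<longleftrightarrow> cmap c y $ i \<noteq> 0" for y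
          by (auto simp: stratum_space_def axis_def)
        then show ?thesis using eq by blast
      qed
      then have "z \<in> S" by (rule strata[OF c(1) x(1) c(2) zc])
      then show ?thesis using x(2) z(2) by metis
    qed
    define t where "t = min e1 e2 / 2"
    have t: "t > 0" "\<bar>t\<bar> < min e1 e2" "\<bar>-t\<bar> < min e1 e2" using e1(1) e2(1) by (auto simp: t_def)
    have "(norm (proj x + t *\<^sub>R w))\<^sup>2 \<le> (norm (proj x))\<^sup>2" "(norm (proj x + (-t) *\<^sub>R w))\<^sup>2 \<le> (norm (proj x))\<^sup>2"
      using bound[OF t(2)] bound[OF t(3)] by (auto intro: power_mono)
    then have "t * t * (w \<bullet> w) \<le> 0"
      by (simp add: power2_norm_eq_inner inner_simps algebra_simps inner_commute)
    moreover have "t * t * (w \<bullet> w) > 0" using t(1) \<open>w \<noteq> 0\<close> by simp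
    ultimately show False by simp
  qed
  then have "act g x = x" for g unfolding std_fixed_iff[OF c(1,2)] by blast
  then show ?thesis using that x(1) by blast
qed

lemma global_fixed_point_exists: obtains x where "\<forall>g. act g x = x"
  using global_fixed_point[of UNIV] by auto

lemma reflection_at_fixed_point:
  assumes r: "r \<in> reflections"
  obtains x where "x \<in> mirror r" "\<forall>g. act g x = x"
proof (rule global_fixed_point[of "mirror r"])
  have r0: "r \<noteq> 0" using r by (simp add: reflections_def)
  show "closed (mirror r)" by (simp add: mirror_def)
  show "mirror r \<noteq> {}" by (rule reflection_mirror_nonempty[OF r])
  show "z \<in> mirror r" if c: "std c \<theta>" and "x \<in> mirror r" and x: "x \<in> cdom c" and z: "z \<in> cdom c"
    and "\<And>i. cmap c z $ i = 0 \<longleftrightarrow> cmap c x $ i = 0" for c \<theta> x z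
    using that unfolding mirror_std_iff[OF c x r0] mirror_std_iff[OF c z r0] by blast
qed (use that in blast)

end

section \<open>The orientation character of an orientable manifold\<close>

context standard_mfd
begin

text \<open>Each group element acts on an oriented connected manifold with one sign, everywhere preserving or
  everywhere reversing the orientation. A reflection reverses it, as seen at a point that it fixes.\<close>

lemma orientable_reflective:
  assumes con: "connected (UNIV :: 'x set)" and ori: "orientable A"
  shows "\<exists>\<epsilon>. reflective \<epsilon>"
proof -
  obtain B where B': "B \<subseteq> M \<and> (\<Union>c\<in>B. cdom c) = UNIV \<and>
      (\<forall>c\<in>B. \<forall>d\<in>B. \<forall>y\<in>cmap c ` (cdom c \<inter> cdom d).
        det (matrix (frechet_derivative (transition c d) (at y))) > 0)"
    using ori unfolding orientable_def ..
  then have B: "B \<subseteq> M" "(\<Union>c\<in>B. cdom c) = UNIV" by simp_all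
  have jacB: "jac_sign b b' x = 1" if "b \<in> B" "b' \<in> B" "x \<in> cdom b" "x \<in> cdom b'" for b b' x
  proof -
    have "det (matrix (tder b b' x)) > 0" using B' that by (simp add: tder_def)
    then show ?thesis by (simp add: jac_sign_def)
  qed
  define at_pt where "at_pt x = (SOME b. b \<in> B \<and> x \<in> cdom b)" for x
  have at_pt: "at_pt x \<in> B" "x \<in> cdom (at_pt x)" for x
  proof -
    have "\<exists>b. b \<in> B \<and> x \<in> cdom b" using B(2) by blast
    then show "at_pt x \<in> B" "x \<in> cdom (at_pt x)"
      unfolding at_pt_def by (metis (mono_tags, lifting) someI_ex)+
  qed
  \<comment> \<open>The sign of a chart relative to the given orientation.\<close>
  define osign where "osign c x = jac_sign c (at_pt x) x" for c x
  have osign: "osign c x = jac_sign c b x" if "c \<in> M" "x \<in> cdom c" "b \<in> B" "x \<in> cdom b" for c b x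
  proof -
    have "jac_sign c b x = jac_sign c (at_pt x) x * jac_sign (at_pt x) b x"
      using that at_pt[of x] B(1) by (intro jac_sign_compose) auto
    then show ?thesis using jacB[OF at_pt(1) that(3) at_pt(2) that(4)] by (simp add: osign_def)
  qed
  have osign_cases: "osign c x = 1 \<or> osign c x = -1" if "c \<in> M" "x \<in> cdom c" for c x
    unfolding osign_def using that at_pt[of x] B(1) by (intro jac_sign_cases) auto
  have osign_sq: "osign c x * osign c x = 1" if "c \<in> M" "x \<in> cdom c" for c x
    using osign_cases[OF that] by auto
  have osign_loc: "\<exists>V. open V \<and> x \<in> V \<and> V \<subseteq> cdom c \<and> (\<forall>y\<in>V. osign c y = osign c x)"
    if c: "c \<in> M" "x \<in> cdom c" for c x
  proof -
    obtain V where V: "open V" "x \<in> V" "V \<subseteq> cdom c \<inter> cdom (at_pt x)"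
      "\<And>y. y \<in> V \<Longrightarrow> jac_sign c (at_pt x) y = jac_sign c (at_pt x) x"
      using jac_sign_locally_constant[OF c(1) _ c(2) at_pt(2)] at_pt(1) B(1) by blast
    have "osign c y = osign c x" if "y \<in> V" for y
    proof -
      have "osign c y = jac_sign c (at_pt x) y" using that V(3) c at_pt(1) by (intro osign) auto
      then show ?thesis using V(4)[OF that] by (simp add: osign_def)
    qed
    then show ?thesis using V by blast
  qed
  have osign_change: "osign d x = osign c x * jac_sign c d x"
    if "c \<in> M" "d \<in> M" "x \<in> cdom c" "x \<in> cdom d" for c d x
  proof -
    have "osign d x = jac_sign d c x * osign c x"
      unfolding osign_def using that at_pt[of x] B(1) by (intro jac_sign_compose) auto
    then show ?thesis using jac_sign_sym[OF that] by simp
  qed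

  \<comment> \<open>The sign of \<open>g\<close> at \<open>x\<close>, computed in a standard chart; it does not depend on the chart.\<close>
  define e where "e c \<theta> g x = osign c x * osign c (act g x) * total_sign (\<theta> g)"
    for c and \<theta> :: "bit^'n \<Rightarrow> bit^'n" and g x
  have e_indep: "e d \<eta> g x = e c \<theta> g x"
    if c: "std c \<theta>" and d: "std d \<eta>" and x: "x \<in> cdom c" "x \<in> cdom d" for c \<theta> d \<eta> g x
  proof -
    note M = stdD(1)[OF c] stdD(1)[OF d]
    have "osign d (act g x) = osign c (act g x) * (total_sign (\<theta> g) * total_sign (\<eta> g) * jac_sign c d x)"
      using osign_change[OF M, of "act g x"] stdD(4)[OF c x(1)] stdD(4)[OF d x(2)]
        jac_sign_equivariant[OF c d x] by simp
    then have "e d \<eta> g x = (osign c x * jac_sign c d x) *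
        (osign c (act g x) * (total_sign (\<theta> g) * total_sign (\<eta> g) * jac_sign c d x)) * total_sign (\<eta> g)"
      unfolding e_def osign_change[OF M x] by simp
    also have "\<dots> = e c \<theta> g x * (jac_sign c d x * jac_sign c d x) * (total_sign (\<eta> g) * total_sign (\<eta> g))"
      by (simp add: e_def mult_ac)
    also have "\<dots> = e c \<theta> g x" using jac_sign_cases[OF M x] by auto
    finally show ?thesis .
  qed
  define E where "E g x = (let p = (SOME p. std (fst p) (snd p) \<and> x \<in> cdom (fst p)) in e (fst p) (snd p) g x)" for g x
  have E: "E g x = e c \<theta> g x" if "std c \<theta>" "x \<in> cdom c" for c \<theta> g x
  proof -
    let ?p = "SOME p. std (fst p) (snd p) \<and> x \<in> cdom (fst p)"
    have "\<exists>p. std (fst p) (snd p) \<and> x \<in> cdom (fst p)" using that by (intro exI[of _ "(c, \<theta>)"]) simp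
    then have "std (fst ?p) (snd ?p) \<and> x \<in> cdom (fst ?p)" by (rule someI_ex)
    then show ?thesis unfolding E_def Let_def using e_indep that by blast
  qed
  have const: "E g x = E g y" for g x y
  proof -
    have "E g constant_on UNIV"
    proof (rule locally_constant_imp_constant[OF con])
      fix x
      obtain c \<theta> where c: "std c \<theta>" "x \<in> cdom c" by (rule std_exists)
      note M = stdD(1)[OF c(1)]
      obtain V where V: "open V" "x \<in> V" "V \<subseteq> cdom c" "\<And>y. y \<in> V \<Longrightarrow> osign c y = osign c x"
        using osign_loc[OF M c(2)] by blast
      obtain W where W: "open W" "act g x \<in> W" "W \<subseteq> cdom c" "\<And>y. y \<in> W \<Longrightarrow> osign c y = osign c (act g x)"
        using osign_loc[OF M stdD(4)[OF c, where g = g]] by blast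
      have "open (V \<inter> act g -` W)"
        using V(1) W(1) act_continuous[of UNIV g] by (simp add: continuous_on_open_vimage[OF open_UNIV] open_Int)
      moreover have "E g y = E g x" if "y \<in> V \<inter> act g -` W" for y
      proof -
        have "y \<in> cdom c" using that V(3) by blast
        then show ?thesis using that V(4)[of y] W(4)[of "act g y"] by (simp add: E[OF c(1)] c(2) e_def)
      qed
      ultimately show "\<exists>T. openin (top_of_set UNIV) T \<and> x \<in> T \<and> (\<forall>y\<in>T. E g y = E g x)"
        using V(2) W(2) unfolding subtopology_UNIV open_openin[symmetric]
        by (intro exI[of _ "V \<inter> act g -` W"]) blast
    qed
    then show ?thesis unfolding constant_on_def by auto
  qed
  have E_cases: "E g x = 1 \<or> E g x = -1" for g x
  proof -
    obtain c \<theta> where c: "std c \<theta>" "x \<in> cdom c" by (rule std_exists)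
    have "osign c x = 1 \<or> osign c x = -1" "osign c (act g x) = 1 \<or> osign c (act g x) = -1"
      using osign_cases stdD(1,4)[OF c(1)] c(2) by blast+
    then show ?thesis using total_sign_cases[of "\<theta> g"] by (auto simp: E[OF c] e_def)
  qed
  have E_add: "E (g + h) x = E g x * E h x" for g h x
  proof -
    obtain c \<theta> where c: "std c \<theta>" "x \<in> cdom c" by (rule std_exists)
    have hx: "act h x \<in> cdom c" using stdD(4)[OF c] .
    have "E g x * E h x = E g (act h x) * E h x" using const by metis
    also have "\<dots> = (osign c (act h x) * osign c (act h x)) *
        (osign c x * osign c (act g (act h x)) * (total_sign (\<theta> g) * total_sign (\<theta> h)))"
      by (simp add: E[OF c(1) hx] E[OF c] e_def)
    also have "\<dots> = E (g + h) x"
      using osign_sq[OF stdD(1)[OF c(1)] hx]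
      by (simp add: E[OF c] e_def act_add automorphism_add[OF stdD(3)[OF c(1)]] total_sign_add)
    finally show ?thesis by simp
  qed
  obtain x0 :: 'x where True by blast
  define \<epsilon> :: "bit^'n \<Rightarrow> bit" where "\<epsilon> g = (if E g x0 = 1 then 0 else 1)" for g
  have \<epsilon>: "bit_sign (\<epsilon> g) = E g x0" for g using E_cases[of g x0] by (auto simp: \<epsilon>_def)
  have "additive \<epsilon>"
  proof (intro allI)
    fix g h
    have "bit_sign (\<epsilon> (g + h)) = bit_sign (\<epsilon> g + \<epsilon> h)" by (simp add: \<epsilon> E_add bit_sign_add)
    then show "\<epsilon> (g + h) = \<epsilon> g + \<epsilon> h" by simp
  qed
  moreover have "\<epsilon> r = 1" if r: "r \<in> reflections" for r
  proof -
    obtain x where x: "r \<noteq> 0" "stab x = {0, r}" using r unfolding reflections_def by blast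
    obtain c \<theta> where c: "std c \<theta>" "x \<in> cdom c" by (rule std_exists)
    obtain i where i: "\<theta> r = axis i 1" using stab_pair_std[OF c x] by blast
    have "act r x = x" using x(2) unfolding stab_def by blast
    then have "E r x = -1"
      using osign_sq[OF stdD(1)[OF c(1)] c(2)] by (simp add: E[OF c] e_def i total_sign_axis)
    then have "bit_sign (\<epsilon> r) = bit_sign 1" using \<epsilon> const[of r x x0] by simp
    then show ?thesis by (simp only: bit_sign_eq_iff)
  qed
  ultimately show ?thesis unfolding reflective_def by blast
qed

end


section \<open>Gluing over a convex set\<close>

text \<open>A multiplicative cocycle of signs, defined for nearby points of a bounded convex set, is a
  coboundary: it is multiplied up along subdivided segments that start at a base point.\<close>

lemma cocycle_convex:
  fixes S :: "'a::real_normed_vector set" and \<kappa> :: "'a \<Rightarrow> 'a \<Rightarrow> real"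
  assumes S: "convex S" "bounded S" and \<rho>: "\<rho> > 0"
    and pm: "\<And>p q. p \<in> S \<Longrightarrow> q \<in> S \<Longrightarrow> dist p q < \<rho> \<Longrightarrow> \<kappa> p q = 1 \<or> \<kappa> p q = -1"
    and coc: "\<And>p q r. p \<in> S \<Longrightarrow> q \<in> S \<Longrightarrow> r \<in> S \<Longrightarrow> dist p q < \<rho> \<Longrightarrow> dist q r < \<rho> \<Longrightarrow> dist p r < \<rho> \<Longrightarrow>
      \<kappa> p q * \<kappa> q r = \<kappa> p r"
  obtains a where "\<And>p. p \<in> S \<Longrightarrow> a p = 1 \<or> a p = -1"
    "\<And>p q. p \<in> S \<Longrightarrow> q \<in> S \<Longrightarrow> dist p q < \<rho> / 2 \<Longrightarrow> \<kappa> p q = a p * a q"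
proof (cases "S = {}")
  case False
  then obtain p0 where p0: "p0 \<in> S" by blast
  obtain R where R: "\<And>p. p \<in> S \<Longrightarrow> dist p0 p \<le> R"
    using S(2) bounded_any_center[of S p0] by blast
  have "R \<ge> 0" using R[OF p0] by simp
  obtain N where N: "N > 0" "R / real N < \<rho> / 2"
  proof -
    obtain N where "2 * R / \<rho> < real N" using reals_Archimedean2 by blast
    moreover have "2 * R / \<rho> \<ge> 0" using \<open>R \<ge> 0\<close> \<rho> by simp
    ultimately have N: "N > 0" by (cases "N = 0") auto
    have "2 * R < real N * \<rho>" using \<open>2 * R / \<rho> < real N\<close> \<rho> by (simp add: pos_divide_less_eq)
    then have "R / real N < \<rho> / 2" using N by (simp add: pos_divide_less_eq mult.commute)
    then show ?thesis using that N by blast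
  qed
  define pt where "pt k p = p0 + (real k / real N) *\<^sub>R (p - p0)" for k p
  have pt_S: "pt k p \<in> S" if "k \<le> N" "p \<in> S" for k p
  proof -
    have "pt k p = (1 - real k / real N) *\<^sub>R p0 + (real k / real N) *\<^sub>R p"
      by (simp add: pt_def algebra_simps)
    then show ?thesis using convexD_alt[OF S(1) p0 that(2), of "real k / real N"] that(1) N(1) by simp
  qed
  have pt_step: "dist (pt k p) (pt (Suc k) p) < \<rho> / 2" if "p \<in> S" for k p
  proof -
    have "pt k p - pt (Suc k) p = (- 1 / real N) *\<^sub>R (p - p0)"
      by (simp add: pt_def algebra_simps add_divide_distrib)
    then have "dist (pt k p) (pt (Suc k) p) = dist p0 p / real N"
      by (simp add: dist_norm norm_minus_commute)
    also have "\<dots> \<le> R / real N" using R[OF that] by (simp add: divide_right_mono)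
    finally show ?thesis using N(2) by linarith
  qed
  have pt_pt: "dist (pt k p) (pt k q) \<le> dist p q" if "k \<le> N" for k p q
  proof -
    have "pt k p - pt k q = (real k / real N) *\<^sub>R (p - q)"
      by (simp add: pt_def algebra_simps)
    then have "dist (pt k p) (pt k q) = (real k / real N) * dist p q"
      by (simp add: dist_norm)
    also have "\<dots> \<le> 1 * dist p q" using that N(1) by (intro mult_right_mono) auto
    finally show ?thesis by simp
  qed
  have near: "dist (pt k p) (pt (Suc k) q) < \<rho>" if "k \<le> N" "q \<in> S" "dist p q < \<rho> / 2" for k p q
    using dist_triangle[of "pt k p" "pt (Suc k) q" "pt k q"] pt_pt[OF that(1), of p q] pt_step[OF that(2), of k] that(3)
    by simp
  define a where "a k p = (\<Prod>j<k. \<kappa> (pt j p) (pt (Suc j) p))" for k p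
  have a_pm: "a k p = 1 \<or> a k p = -1" if "k \<le> N" "p \<in> S" for k p
    using that(1)
  proof (induction k)
    case 0
    show ?case by (simp add: a_def)
  next
    case (Suc k)
    have "\<kappa> (pt k p) (pt (Suc k) p) = 1 \<or> \<kappa> (pt k p) (pt (Suc k) p) = -1"
      using Suc.prems pt_S[of k p] pt_S[of "Suc k" p] that(2) pt_step[OF that(2), of k] \<rho>
      by (intro pm) auto
    then show ?case using Suc by (auto simp: a_def)
  qed
  have main: "a k p * \<kappa> (pt k p) (pt k q) = a k q" if "p \<in> S" "q \<in> S" "dist p q < \<rho> / 2" "k \<le> N" for k p q
    using that(4)
  proof (induction k)
    case 0
    have "\<kappa> p0 p0 * \<kappa> p0 p0 = \<kappa> p0 p0" using coc[OF p0 p0 p0] \<rho> by simp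
    moreover have "\<kappa> p0 p0 = 1 \<or> \<kappa> p0 p0 = -1" using pm[OF p0 p0] \<rho> by simp
    ultimately have "\<kappa> p0 p0 = 1" by auto
    then show ?case by (simp add: a_def pt_def)
  next
    case (Suc k)
    have k: "k \<le> N" using Suc.prems by simp
    have mem: "pt k p \<in> S" "pt (Suc k) p \<in> S" "pt k q \<in> S" "pt (Suc k) q \<in> S"
      using pt_S Suc.prems k that by blast+
    have d: "dist (pt k p) (pt (Suc k) p) < \<rho>" "dist (pt k q) (pt (Suc k) q) < \<rho>"
      "dist (pt k p) (pt k q) < \<rho>" "dist (pt (Suc k) p) (pt (Suc k) q) < \<rho>" "dist (pt k p) (pt (Suc k) q) < \<rho>"
      using pt_step[OF that(1), of k] pt_step[OF that(2), of k] pt_pt[OF k, of p q] pt_pt[OF Suc.prems, of p q]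
        near[OF k that(2,3)] that(3) \<rho> by auto
    have "a (Suc k) p * \<kappa> (pt (Suc k) p) (pt (Suc k) q)
        = a k p * (\<kappa> (pt k p) (pt (Suc k) p) * \<kappa> (pt (Suc k) p) (pt (Suc k) q))"
      by (simp add: a_def)
    also have "\<dots> = a k p * \<kappa> (pt k p) (pt (Suc k) q)"
      using coc[OF mem(1,2,4) d(1,4,5)] by simp
    also have "\<dots> = a k p * \<kappa> (pt k p) (pt k q) * \<kappa> (pt k q) (pt (Suc k) q)"
      using coc[OF mem(1,3,4) d(3,2,5)] by simp
    also have "\<dots> = a (Suc k) q" using Suc.IH[OF k] by (simp add: a_def)
    finally show ?case .
  qed
  have ptN: "pt N p = p" for p using N(1) by (simp add: pt_def)
  show ?thesis
  proof (rule that[of "a N"])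
    show "a N p = 1 \<or> a N p = -1" if "p \<in> S" for p using a_pm that by blast
    show "\<kappa> p q = a N p * a N q" if "p \<in> S" "q \<in> S" "dist p q < \<rho> / 2" for p q
      using main[OF that, of N] a_pm[OF _ that(1), of N] by (auto simp: ptN)
  qed
qed (use that in auto)

section \<open>Restricting charts and changing signs of coordinates\<close>

lemma higher_differentiable_on_cong:
  assumes "open S" "\<And>x. x \<in> S \<Longrightarrow> f x = g x" "higher_differentiable_on k S f"
  shows "higher_differentiable_on k S g"
  using assms(2,3)
proof (induction k arbitrary: f g)
  case 0
  then show ?case using continuous_on_cong[of S S f g] by simp
next
  case (Suc k)
  have D: "(g has_derivative frechet_derivative f (at x)) (at x)" if x: "x \<in> S" for x
  proof (rule has_derivative_transform_within_open[OF _ assms(1) x])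
    show "(f has_derivative frechet_derivative f (at x)) (at x)"
      using Suc.prems(2) x frechet_derivative_works by auto
  qed (rule Suc.prems(1))
  have eq: "frechet_derivative f (at x) = frechet_derivative g (at x)" if "x \<in> S" for x
    using D[OF that] by (rule frechet_derivative_at)
  have "higher_differentiable_on k S (\<lambda>x. frechet_derivative g (at x) v)" for v
  proof (rule Suc.IH)
    show "frechet_derivative f (at x) v = frechet_derivative g (at x) v" if "x \<in> S" for x
      using eq[OF that] by simp
    show "higher_differentiable_on k S (\<lambda>x. frechet_derivative f (at x) v)" using Suc.prems(2) by simp
  qed
  then show ?case using D by (auto simp: differentiable_def)
qed

lemma higher_differentiable_on_subset:
  "higher_differentiable_on k S f \<Longrightarrow> T \<subseteq> S \<Longrightarrow> higher_differentiable_on k T f"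
  by (induction k arbitrary: f) (auto intro: continuous_on_subset)

lemma higher_differentiable_on_linear:
  assumes "open S" "bounded_linear L" "higher_differentiable_on k S f"
  shows "higher_differentiable_on k S (\<lambda>x. L (f x))"
  using assms(3)
proof (induction k arbitrary: f)
  case 0
  then show ?case using assms(2) by (simp add: bounded_linear.continuous_on)
next
  case (Suc k)
  have D: "((\<lambda>x. L (f x)) has_derivative (\<lambda>v. L (frechet_derivative f (at x) v))) (at x)" if "x \<in> S" for x
    using Suc.prems that frechet_derivative_works
    by (intro bounded_linear.has_derivative[OF assms(2)]) auto
  have "higher_differentiable_on k S (\<lambda>x. frechet_derivative (\<lambda>x. L (f x)) (at x) v)" for v
  proof (rule higher_differentiable_on_cong[OF assms(1)])
    show "higher_differentiable_on k S (\<lambda>x. L (frechet_derivative f (at x) v))"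
      using Suc by auto
    show "L (frechet_derivative f (at x) v) = frechet_derivative (\<lambda>x. L (f x)) (at x) v" if "x \<in> S" for x
      using frechet_derivative_at[OF D[OF that]] by metis
  qed
  then show ?case using D by (auto simp: differentiable_def)
qed

lemma open_sign_action_image:
  assumes "open S" shows "open (sign_action g ` S)"
proof -
  have "sign_action g ` S = sign_action g -` S"
    by (auto simp: image_iff) (metis sign_action_involution)
  moreover have "open (sign_action g -` S)"
    using assms linear_continuous_on[OF bounded_linear_sign_action, of UNIV g]
    by (simp add: continuous_on_open_vimage[OF open_UNIV])
  ultimately show ?thesis by simp
qed

lemma higher_differentiable_on_sign_action:
  fixes f :: "real^'n::finite \<Rightarrow> 'b::euclidean_space"
  assumes "open S" "higher_differentiable_on k S f"
  shows "higher_differentiable_on k (sign_action g ` S) (\<lambda>y. f (sign_action g y))"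
  using assms(2)
proof (induction k arbitrary: f)
  case 0
  have "continuous_on (sign_action g ` S) (\<lambda>y. f (sign_action g y))"
  proof (rule continuous_on_compose2[of S f])
    show "continuous_on S f" using 0 by simp
    show "continuous_on (sign_action g ` S) (sign_action g)"
      by (rule linear_continuous_on[OF bounded_linear_sign_action])
    show "sign_action g ` sign_action g ` S \<subseteq> S" by auto
  qed
  then show ?case by simp
next
  case (Suc k)
  have opn: "open (sign_action g ` S)" using assms(1) by (rule open_sign_action_image)
  have D: "((\<lambda>y. f (sign_action g y)) has_derivative
      (\<lambda>v. frechet_derivative f (at (sign_action g y)) (sign_action g v))) (at y)"
    if y: "y \<in> sign_action g ` S" for y
  proof -
    have "sign_action g y \<in> S" using y by auto
    then have "(f has_derivative frechet_derivative f (at (sign_action g y))) (at (sign_action g y))"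
      using Suc.prems frechet_derivative_works by auto
    from diff_chain_at[OF sign_action_has_derivative this] show ?thesis by (simp add: o_def)
  qed
  have "higher_differentiable_on k (sign_action g ` S) (\<lambda>y. frechet_derivative (\<lambda>y. f (sign_action g y)) (at y) v)" for v
  proof (rule higher_differentiable_on_cong[OF opn])
    show "higher_differentiable_on k (sign_action g ` S)
        (\<lambda>y. frechet_derivative f (at (sign_action g y)) (sign_action g v))"
      using Suc.prems by (intro Suc.IH[of "\<lambda>y. frechet_derivative f (at y) (sign_action g v)"]) auto
    show "frechet_derivative f (at (sign_action g y)) (sign_action g v) =
        frechet_derivative (\<lambda>y. f (sign_action g y)) (at y) v" if "y \<in> sign_action g ` S" for y
      using frechet_derivative_at[OF D[OF that]] by metis
  qed
  then show ?case using D by (auto simp: differentiable_def)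
qed

text \<open>The chart \<open>c\<close> restricted to \<open>D\<close>, with the signs of some coordinates changed.\<close>

definition signed_chart :: "('x, 'n::finite) chart \<Rightarrow> bit^'n \<Rightarrow> 'x set \<Rightarrow> ('x, 'n) chart" where
  "signed_chart c g D = (D, \<lambda>x. sign_action g (cmap c x))"

lemma signed_chart_simps [simp]:
  "cdom (signed_chart c g D) = D" "cmap (signed_chart c g D) x = sign_action g (cmap c x)"
  by (simp_all add: signed_chart_def)

lemma sign_action_inj: "sign_action g y = sign_action g z \<longleftrightarrow> y = z"
  by (metis sign_action_involution)

lemma signed_chart_is_chart:
  fixes c :: "('x::topological_space, 'n::finite) chart"
  assumes c: "is_chart c" and D: "open D" "D \<subseteq> cdom c"
  shows "is_chart (signed_chart c g D)"
    and "\<And>x. x \<in> D \<Longrightarrow> cinv (signed_chart c g D) (sign_action g (cmap c x)) = x"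
proof -
  let ?s = "signed_chart c g D"
  have inj: "inj_on (cmap ?s) D"
    using chart_inj[OF c] D(2) by (auto simp: inj_on_def sign_action_inj)
  show inv: "cinv ?s (sign_action g (cmap c x)) = x" if "x \<in> D" for x
    using the_inv_into_f_f[OF inj that] by (simp add: cinv_def)
  have img: "cmap ?s ` D = sign_action g ` cmap c ` D" by (simp add: image_image)
  have cont_s: "continuous_on S (sign_action g)" for S :: "(real^'n) set"
    by (rule linear_continuous_on[OF bounded_linear_sign_action])
  have "homeomorphism D (cmap ?s ` D) (cmap ?s) (cinv ?s)"
    unfolding homeomorphism_def
  proof (intro conjI ballI)
    show "cinv ?s (cmap ?s x) = x" if "x \<in> D" for x using inv[OF that] by simp
    show "cinv ?s ` cmap ?s ` D = D" using inv by (auto simp: image_image)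
    show "cmap ?s (cinv ?s y) = y" if "y \<in> cmap ?s ` D" for y using that inv by auto
    show "continuous_on D (cmap ?s)"
      unfolding signed_chart_def snd_conv
      using continuous_on_subset[OF chart_continuous[OF c] D(2)]
      by (intro continuous_on_compose2[OF cont_s[of UNIV]]) auto
    show "continuous_on (cmap ?s ` D) (cinv ?s)"
    proof (rule continuous_on_eq)
      show "continuous_on (cmap ?s ` D) (\<lambda>y. cinv c (sign_action g y))"
      proof (rule continuous_on_compose2[OF _ cont_s])
        show "continuous_on (cmap c ` cdom c) (cinv c)" using c by (simp add: is_chart_def homeomorphism_def)
        show "sign_action g ` cmap ?s ` D \<subseteq> cmap c ` cdom c" using D(2) by auto
      qed
      show "cinv c (sign_action g y) = cinv ?s y" if "y \<in> cmap ?s ` D" for y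
        using that inv chart_cinv_cmap[OF c] D(2) by auto
    qed
  qed simp
  then show "is_chart ?s"
    unfolding is_chart_def using D open_sign_action_image[OF chart_open_image[OF c D]] img by simp
qed

lemma smooth_on_cong: "open S \<Longrightarrow> (\<And>x. x \<in> S \<Longrightarrow> f x = g x) \<Longrightarrow> smooth_on S f \<Longrightarrow> smooth_on S g"
  unfolding smooth_on_def using higher_differentiable_on_cong by blast

lemma signed_chart_compatible:
  assumes c: "is_chart c" and D: "open D" "D \<subseteq> cdom c" and a: "is_chart a" and ca: "compatible c a"
  shows "compatible (signed_chart c g D) a"
proof -
  let ?s = "signed_chart c g D" and ?T = "cmap c ` (D \<inter> cdom a)"
  have opn: "open ?T" "open (cmap a ` (D \<inter> cdom a))"
    using c a D by (auto intro!: chart_open_image simp: open_Int chart_open_dom)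
  have sm: "smooth_on ?T (transition c a)" "smooth_on (cmap a ` (D \<inter> cdom a)) (transition a c)"
    using ca D(2) unfolding compatible_def smooth_on_def by (blast intro: higher_differentiable_on_subset)+
  have "smooth_on (sign_action g ` ?T) (transition ?s a)"
  proof (rule smooth_on_cong)
    show "open (sign_action g ` ?T)" using opn(1) by (rule open_sign_action_image)
    show "smooth_on (sign_action g ` ?T) (\<lambda>y. transition c a (sign_action g y))"
      using sm(1) opn(1) higher_differentiable_on_sign_action unfolding smooth_on_def by blast
    show "transition c a (sign_action g y) = transition ?s a y" if "y \<in> sign_action g ` ?T" for y
      using that signed_chart_is_chart(2)[OF c D, of _ g] chart_cinv_cmap[OF c] D(2)
      by (auto simp: transition_def)
  qed
  moreover have "smooth_on (cmap a ` (D \<inter> cdom a)) (transition a ?s)"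
  proof -
    have "transition a ?s = (\<lambda>y. sign_action g (transition a c y))"
      by (simp add: transition_def fun_eq_iff)
    moreover have "smooth_on (cmap a ` (D \<inter> cdom a)) (\<lambda>y. sign_action g (transition a c y))"
      using sm(2) higher_differentiable_on_linear[OF opn(2) bounded_linear_sign_action]
      unfolding smooth_on_def by blast
    ultimately show ?thesis by simp
  qed
  ultimately show ?thesis by (simp add: compatible_def image_image)
qed

context smooth_mfd
begin

lemma signed_chart_smooth:
  assumes c: "c \<in> M" and D: "open D" "D \<subseteq> cdom c"
  shows "signed_chart c g D \<in> M"
  unfolding smooth_charts_def
  using signed_chart_is_chart(1)[OF _ D] signed_chart_compatible[OF _ D] smooth_chartsD[OF c] atlas_chart
  by blast

lemma jac_sign_signed_chart_self:
  assumes c: "c \<in> M" and D: "open D" "D \<subseteq> cdom c" and x: "x \<in> D"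
  shows "jac_sign c (signed_chart c g D) x = total_sign g"
proof -
  let ?s = "signed_chart c g D"
  note isc = smooth_chartsD(1)[OF c]
  have "(transition c ?s has_derivative sign_action g) (at (cmap c x))"
  proof (rule has_derivative_transform_within_open)
    show "(sign_action g has_derivative sign_action g) (at (cmap c x))" by (rule sign_action_has_derivative)
    show "open (cmap c ` D)" using chart_open_image[OF isc D] .
    show "cmap c x \<in> cmap c ` D" using x by blast
    show "sign_action g y = transition c ?s y" if "y \<in> cmap c ` D" for y
      using that D(2) by (auto simp: transition_def chart_cinv_cmap[OF isc])
  qed
  then have "tder c ?s x = sign_action g"
    unfolding tder_def by (metis frechet_derivative_at)
  moreover have "sgn (total_sign g) = total_sign g" using total_sign_cases[of g] by auto
  ultimately show ?thesis by (simp add: jac_sign_def det_sign_action)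
qed

lemma jac_sign_signed_chart:
  assumes c: "c \<in> M" "open D" "D \<subseteq> cdom c" and d: "d \<in> M" "open E" "E \<subseteq> cdom d" and x: "x \<in> D" "x \<in> E"
  shows "jac_sign (signed_chart c g D) (signed_chart d k E) x = total_sign g * total_sign k * jac_sign c d x"
proof -
  let ?s = "signed_chart c g D" and ?t = "signed_chart d k E"
  have M: "?s \<in> M" "?t \<in> M" using signed_chart_smooth c d by blast+
  have xc: "x \<in> cdom c" "x \<in> cdom d" "x \<in> cdom ?s" "x \<in> cdom ?t" using x c(3) d(3) by auto
  have "jac_sign ?s ?t x = jac_sign ?s c x * jac_sign c ?t x"
    by (rule jac_sign_compose[OF M(1) c(1) M(2) xc(3,1,4)])
  also have "jac_sign c ?t x = jac_sign c d x * jac_sign d ?t x"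
    by (rule jac_sign_compose[OF c(1) d(1) M(2) xc(1,2,4)])
  also have "jac_sign ?s c x = total_sign g"
    using jac_sign_sym[OF c(1) M(1) xc(1,3)] jac_sign_signed_chart_self[OF c x(1)] by simp
  also have "jac_sign d ?t x = total_sign k"
    by (rule jac_sign_signed_chart_self[OF d x(2)])
  finally show ?thesis by simp
qed

lemma orientableI:
  assumes "B \<subseteq> M" "(\<Union>c\<in>B. cdom c) = UNIV"
    and jac: "\<And>c d x. c \<in> B \<Longrightarrow> d \<in> B \<Longrightarrow> x \<in> cdom c \<Longrightarrow> x \<in> cdom d \<Longrightarrow> jac_sign c d x = 1"
  shows "orientable A"
  unfolding orientable_def
proof (intro exI[of _ B] conjI ballI)
  fix c d y assume cd: "c \<in> B" "d \<in> B" and "y \<in> cmap c ` (cdom c \<inter> cdom d)"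
  then obtain x where x: "x \<in> cdom c" "x \<in> cdom d" "y = cmap c x" by blast
  then show "det (matrix (frechet_derivative (transition c d) (at y))) > 0"
    using jac[OF cd x(1,2)] by (simp add: jac_sign_def tder_def sgn_1_pos)
qed (use assms in auto)

end

section \<open>Orienting a small cover by a reflective homomorphism\<close>

context standard_mfd
begin

text \<open>The locally constant sign by which a standard chart has to be corrected. If \<open>\<epsilon>\<close> is reflective, it
  involves only coordinates that do not vanish anywhere on the chart, and the action of \<open>g\<close> multiplies
  it by the determinant of \<open>g\<close> in the chart times the sign of \<open>\<epsilon> g\<close>.\<close>

definition correction :: "(bit^'n \<Rightarrow> bit) \<Rightarrow> ('x, 'n) chart \<Rightarrow> (bit^'n \<Rightarrow> bit^'n) \<Rightarrow> 'x \<Rightarrow> real" where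
  "correction \<epsilon> c \<theta> x = (\<Prod>i\<in>{i. \<epsilon> (inv \<theta> (axis i 1)) = 0}. sgn (cmap c x $ i))"

lemma correction_cases:
  assumes "reflective \<epsilon>" "std c \<theta>" "x \<in> cdom c"
  shows "correction \<epsilon> c \<theta> x = 1 \<or> correction \<epsilon> c \<theta> x = -1"
proof -
  have nz: "cmap c x $ i \<noteq> 0" if "\<epsilon> (inv \<theta> (axis i 1)) = 0" for i
    using reflective_axis[OF assms, of i] that by auto
  have "\<bar>correction \<epsilon> c \<theta> x\<bar> = 1"
    unfolding correction_def abs_prod by (rule prod.neutral) (use nz in \<open>auto simp: abs_sgn_eq\<close>)
  then show ?thesis by linarith
qed

lemma correction_act:
  assumes refl: "reflective \<epsilon>" and c: "std c \<theta>" and x: "x \<in> cdom c"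
  shows "correction \<epsilon> c \<theta> (act g x) = correction \<epsilon> c \<theta> x * total_sign (\<theta> g) * bit_sign (\<epsilon> g)"
proof -
  let ?I = "{i. \<epsilon> (inv \<theta> (axis i 1)) = 0}"
  have \<epsilon>: "additive \<epsilon>" using refl by (simp add: reflective_def)
  have "bit_sign (\<epsilon> g) = (\<Prod>i\<in>UNIV. bit_sign (\<theta> g $ i * \<epsilon> (inv \<theta> (axis i 1))))"
    by (subst additive_coordinates[OF \<epsilon> stdD(3)[OF c]]) (rule bit_sign_sum)
  also have "\<dots> = (\<Prod>i\<in>- ?I. bit_sign (\<theta> g $ i))"
    by (rule prod.mono_neutral_cong_right) auto
  finally have compl: "bit_sign (\<epsilon> g) = (\<Prod>i\<in>- ?I. bit_sign (\<theta> g $ i))" .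
  have "total_sign (\<theta> g) = (\<Prod>i\<in>?I. bit_sign (\<theta> g $ i)) * (\<Prod>i\<in>- ?I. bit_sign (\<theta> g $ i))"
    unfolding total_sign_def by (subst prod.union_disjoint[symmetric]) (auto intro!: prod.cong)
  then have ts: "total_sign (\<theta> g) * bit_sign (\<epsilon> g) = (\<Prod>i\<in>?I. bit_sign (\<theta> g $ i))"
    unfolding compl[symmetric] by (simp add: mult.assoc)
  have sgn_bit: "sgn (bit_sign b) = bit_sign b" for b
    using bit_sign_cases[of b] by auto
  have "correction \<epsilon> c \<theta> (act g x) = (\<Prod>i\<in>?I. bit_sign (\<theta> g $ i) * sgn (cmap c x $ i))"
    unfolding correction_def by (simp add: stdD(5)[OF c x] sgn_mult sgn_bit)
  also have "\<dots> = (\<Prod>i\<in>?I. bit_sign (\<theta> g $ i)) * correction \<epsilon> c \<theta> x"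
    by (simp add: correction_def prod.distrib)
  finally show ?thesis unfolding ts[symmetric] by (simp add: mult_ac)
qed

lemma correction_locally_constant:
  assumes refl: "reflective \<epsilon>" and c: "std c \<theta>" and x: "x \<in> cdom c"
  obtains V where "open V" "x \<in> V" "V \<subseteq> cdom c" "\<forall>y\<in>V. correction \<epsilon> c \<theta> y = correction \<epsilon> c \<theta> x"
proof -
  let ?I = "{i. \<epsilon> (inv \<theta> (axis i 1)) = 0}"
  let ?T = "\<Inter>i\<in>?I. {y :: real^'n. y $ i * cmap c x $ i > 0}"
  have nz: "cmap c x $ i \<noteq> 0" if "i \<in> ?I" for i
    using reflective_axis[OF refl c x, of i] that by auto
  have "open ?T"
    by (intro open_INT ballI open_Collect_less continuous_intros) auto
  then have "open {y \<in> cdom c. cmap c y \<in> ?T}"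
    by (rule chart_open_vimage[OF stdD(2)[OF c]])
  moreover have "x \<in> {y \<in> cdom c. cmap c y \<in> ?T}"
  proof -
    have "cmap c x $ i * cmap c x $ i > 0" if "i \<in> ?I" for i
      using nz[OF that] by (metis not_real_square_gt_zero)
    then show ?thesis using x by blast
  qed
  moreover have "correction \<epsilon> c \<theta> y = correction \<epsilon> c \<theta> x" if "y \<in> {y \<in> cdom c. cmap c y \<in> ?T}" for y
    unfolding correction_def
  proof (rule prod.cong)
    fix i assume "i \<in> ?I"
    then have "cmap c y $ i * cmap c x $ i > 0" using that by blast
    then show "sgn (cmap c y $ i) = sgn (cmap c x $ i)"
      by (auto simp: zero_less_mult_iff)
  qed simp
  ultimately show ?thesis using that[of "{y \<in> cdom c. cmap c y \<in> ?T}"] by blast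
qed

text \<open>The sign comparing the corrected orientations of two standard charts. For a reflective \<open>\<epsilon>\<close> it is
  locally constant and invariant under the action, so that it descends to the orbit space.\<close>

definition discrepancy ::
  "(bit^'n \<Rightarrow> bit) \<Rightarrow> ('x, 'n) chart \<Rightarrow> (bit^'n \<Rightarrow> bit^'n) \<Rightarrow> ('x, 'n) chart \<Rightarrow> (bit^'n \<Rightarrow> bit^'n) \<Rightarrow> 'x \<Rightarrow> real" where
  "discrepancy \<epsilon> c \<theta> d \<eta> x = correction \<epsilon> c \<theta> x * correction \<epsilon> d \<eta> x * jac_sign c d x"

lemma discrepancy_act:
  assumes refl: "reflective \<epsilon>" and c: "std c \<theta>" and d: "std d \<eta>" and x: "x \<in> cdom c" "x \<in> cdom d"
  shows "discrepancy \<epsilon> c \<theta> d \<eta> (act g x) = discrepancy \<epsilon> c \<theta> d \<eta> x"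
proof -
  have "discrepancy \<epsilon> c \<theta> d \<eta> (act g x) = discrepancy \<epsilon> c \<theta> d \<eta> x *
      (total_sign (\<theta> g) * total_sign (\<theta> g)) * (total_sign (\<eta> g) * total_sign (\<eta> g)) *
      (bit_sign (\<epsilon> g) * bit_sign (\<epsilon> g))"
    unfolding discrepancy_def correction_act[OF refl c x(1)] correction_act[OF refl d x(2)]
      jac_sign_equivariant[OF c d x]
    by (simp only: mult_ac)
  then show ?thesis by simp
qed

lemma discrepancy_cases:
  assumes refl: "reflective \<epsilon>" and c: "std c \<theta>" and d: "std d \<eta>" and x: "x \<in> cdom c" "x \<in> cdom d"
  shows "discrepancy \<epsilon> c \<theta> d \<eta> x = 1 \<or> discrepancy \<epsilon> c \<theta> d \<eta> x = -1"
  using correction_cases[OF refl c x(1)] correction_cases[OF refl d x(2)]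
    jac_sign_cases[OF stdD(1)[OF c] stdD(1)[OF d] x]
  unfolding discrepancy_def by auto

lemma discrepancy_compose:
  assumes refl: "reflective \<epsilon>" and c: "std c \<theta>" and d: "std d \<eta>" and e: "std e \<zeta>"
    and x: "x \<in> cdom c" "x \<in> cdom d" "x \<in> cdom e"
  shows "discrepancy \<epsilon> c \<theta> d \<eta> x * discrepancy \<epsilon> d \<eta> e \<zeta> x = discrepancy \<epsilon> c \<theta> e \<zeta> x"
proof -
  have "correction \<epsilon> d \<eta> x * correction \<epsilon> d \<eta> x = 1"
    using correction_cases[OF refl d x(2)] by auto
  moreover have "discrepancy \<epsilon> c \<theta> d \<eta> x * discrepancy \<epsilon> d \<eta> e \<zeta> x =
      correction \<epsilon> c \<theta> x * correction \<epsilon> e \<zeta> x * (jac_sign c d x * jac_sign d e x) *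
      (correction \<epsilon> d \<eta> x * correction \<epsilon> d \<eta> x)"
    unfolding discrepancy_def by (simp only: mult_ac)
  ultimately show ?thesis
    unfolding discrepancy_def
    using jac_sign_compose[OF stdD(1)[OF c] stdD(1)[OF d] stdD(1)[OF e] x] by simp
qed

lemma discrepancy_locally_constant:
  assumes refl: "reflective \<epsilon>" and c: "std c \<theta>" and d: "std d \<eta>" and x: "x \<in> cdom c" "x \<in> cdom d"
  obtains V where "open V" "x \<in> V" "V \<subseteq> cdom c \<inter> cdom d"
    "\<forall>y\<in>V. discrepancy \<epsilon> c \<theta> d \<eta> y = discrepancy \<epsilon> c \<theta> d \<eta> x"
proof -
  obtain V1 where V1: "open V1" "x \<in> V1" "V1 \<subseteq> cdom c"
    "\<forall>y\<in>V1. correction \<epsilon> c \<theta> y = correction \<epsilon> c \<theta> x"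
    using correction_locally_constant[OF refl c x(1)] .
  obtain V2 where V2: "open V2" "x \<in> V2" "V2 \<subseteq> cdom d"
    "\<forall>y\<in>V2. correction \<epsilon> d \<eta> y = correction \<epsilon> d \<eta> x"
    using correction_locally_constant[OF refl d x(2)] .
  obtain V3 where V3: "open V3" "x \<in> V3" "V3 \<subseteq> cdom c \<inter> cdom d"
    "\<And>y. y \<in> V3 \<Longrightarrow> jac_sign c d y = jac_sign c d x"
    using jac_sign_locally_constant[OF stdD(1)[OF c] stdD(1)[OF d] x] by blast
  show ?thesis
  proof (rule that[of "V1 \<inter> V2 \<inter> V3"])
    show "open (V1 \<inter> V2 \<inter> V3)" "x \<in> V1 \<inter> V2 \<inter> V3" "V1 \<inter> V2 \<inter> V3 \<subseteq> cdom c \<inter> cdom d"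
      using V1(1,2) V2(1,2) V3(1-3) by auto
    show "\<forall>y\<in>V1 \<inter> V2 \<inter> V3. discrepancy \<epsilon> c \<theta> d \<eta> y = discrepancy \<epsilon> c \<theta> d \<eta> x"
      unfolding discrepancy_def using V1(4) V2(4) V3(4) by auto
  qed
qed

end

context small_cover_mfd
begin

lemma std_dom_proj:
  assumes "std c \<theta>" "x \<in> cdom c" "proj y = proj x"
  shows "y \<in> cdom c"
  using proj_eqD[of x y] assms stdD(4)[OF assms(1,2)] by metis

text \<open>The discrepancy is constant over convex parts of the polytope.\<close>

lemma discrepancy_constant:
  assumes refl: "reflective \<epsilon>" and c: "std c \<theta>" and d: "std d \<eta>"
    and T: "convex T" "T \<subseteq> P" and dom: "\<And>z. proj z \<in> T \<Longrightarrow> z \<in> cdom c \<and> z \<in> cdom d"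
    and x: "proj x \<in> T" and y: "proj y \<in> T"
  shows "discrepancy \<epsilon> c \<theta> d \<eta> x = discrepancy \<epsilon> c \<theta> d \<eta> y"
proof -
  let ?\<tau> = "discrepancy \<epsilon> c \<theta> d \<eta>"
  define f where "f p = ?\<tau> (SOME z. proj z = p)" for p
  have f: "f (proj z) = ?\<tau> z" if z: "proj z \<in> T" for z
  proof -
    have "proj (SOME w. proj w = proj z) = proj z" by (rule someI[of _ z]) simp
    then obtain g where "(SOME w. proj w = proj z) = act g z" using proj_eqD[of z] by metis
    then show ?thesis
      unfolding f_def using discrepancy_act[OF refl c d] dom[OF z] by simp
  qed
  have "f constant_on T"
  proof (rule locally_constant_imp_constant[OF convex_connected[OF T(1)]])
    fix p assume p: "p \<in> T"
    then obtain z where z: "proj z = p" using T(2) proj_image by blast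
    have zdom: "z \<in> cdom c" "z \<in> cdom d" using dom z p by auto
    obtain V where V: "open V" "z \<in> V" "V \<subseteq> cdom c \<inter> cdom d" "\<forall>y\<in>V. ?\<tau> y = ?\<tau> z"
      using discrepancy_locally_constant[OF refl c d zdom] .
    define W where "W = (\<Union>g. act g -` V)"
    have "open (act g -` V)" for g
      using V(1) act_continuous[of UNIV g] by (simp add: continuous_on_open_vimage[OF open_UNIV])
    then have "open W" unfolding W_def by blast
    have Winv: "act g w \<in> W" if w: "w \<in> W" for g w
    proof -
      obtain k where "act k w \<in> V" using w unfolding W_def by blast
      then have "act (k + g) (act g w) \<in> V" by (simp add: act_add)
      then show ?thesis unfolding W_def by blast
    qed
    have zW: "z \<in> W" unfolding W_def using V(2) by (metis UN_I UNIV_I act_zero vimageI)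
    have op: "openin (top_of_set T) (T \<inter> proj ` W)"
    proof -
      obtain U where "open U" "proj ` W = P \<inter> U"
        using proj_open_image[OF \<open>open W\<close> Winv] unfolding openin_open by blast
      then have "T \<inter> proj ` W = T \<inter> U" using T(2) by blast
      then show ?thesis using \<open>open U\<close> unfolding openin_open by blast
    qed
    have const: "f q = f p" if q: "q \<in> T \<inter> proj ` W" for q
    proof -
      obtain w where w: "w \<in> W" "q = proj w" using q by blast
      obtain k where k: "act k w \<in> V" using w(1) unfolding W_def by blast
      have "f q = ?\<tau> w" using f[of w] q w(2) by simp
      also have "\<dots> = ?\<tau> (act k w)" using discrepancy_act[OF refl c d] dom[of w] q w(2) by simp
      also have "\<dots> = ?\<tau> z" using V(4) k by blast
      also have "\<dots> = f p" using f[of z] z p by simp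
      finally show ?thesis .
    qed
    show "\<exists>U. openin (top_of_set T) U \<and> p \<in> U \<and> (\<forall>q\<in>U. f q = f p)"
      using op const zW p z by (intro exI[of _ "T \<inter> proj ` W"]) blast
  qed
  then have "f (proj x) = f (proj y)" using x y unfolding constant_on_def by metis
  then show ?thesis using f x y by simp
qed

text \<open>By compactness of the polytope, there is a radius such that each ball of this radius
  around a point of the polytope lies under a standard chart.\<close>

lemma uniform_standard_charts:
  obtains \<rho> where "\<rho> > 0"
    "\<forall>p\<in>P. \<exists>c \<theta>. std c \<theta> \<and> (\<forall>z. proj z \<in> ball p \<rho> \<longrightarrow> z \<in> cdom c)"
proof -
  define \<C> where "\<C> = {T. open T \<and> (\<exists>c \<theta>. std c \<theta> \<and> (\<forall>z. proj z \<in> T \<longrightarrow> z \<in> cdom c))}"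
  have cover: "\<exists>T\<in>\<C>. proj x \<in> T" for x
  proof -
    obtain c \<theta> where c: "std c \<theta>" "x \<in> cdom c" by (rule std_exists)
    obtain T where T: "open T" "proj ` cdom c = P \<inter> T"
      using proj_open_image[OF chart_open_dom[OF stdD(2)[OF c(1)]] stdD(4)[OF c(1)]]
      unfolding openin_open by blast
    have "z \<in> cdom c" if z: "proj z \<in> T" for z
    proof -
      have "proj z \<in> proj ` cdom c" using z proj_in_P T(2) by blast
      then obtain w where "w \<in> cdom c" "proj z = proj w" by blast
      then show ?thesis using std_dom_proj[OF c(1)] by blast
    qed
    then have "T \<in> \<C>" unfolding \<C>_def using T(1) c(1) by blast
    moreover have "proj x \<in> T" using T(2) c(2) by blast
    ultimately show ?thesis by blast
  qed
  have "compact P" using polytope_P by (rule polytope_imp_compact)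
  moreover have "\<C> \<noteq> {}" using cover by blast
  moreover have "P \<subseteq> \<Union>\<C>" using cover proj_image by blast
  moreover have "open B" if "B \<in> \<C>" for B using that by (simp add: \<C>_def)
  ultimately obtain \<delta> where \<delta>: "\<delta> > 0" "\<And>T. T \<subseteq> P \<Longrightarrow> diameter T < \<delta> \<Longrightarrow> \<exists>B\<in>\<C>. T \<subseteq> B"
    using Lebesgue_number_lemma[of P \<C>] by metis
  have "\<exists>c \<theta>. std c \<theta> \<and> (\<forall>z. proj z \<in> ball p (\<delta>/4) \<longrightarrow> z \<in> cdom c)" for p
  proof -
    have "diameter (P \<inter> ball p (\<delta>/4)) \<le> \<delta>/2"
    proof (rule diameter_le)
      show "P \<inter> ball p (\<delta>/4) \<noteq> {} \<or> 0 \<le> \<delta>/2" using \<delta>(1) by simp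
      show "norm (x - y) \<le> \<delta>/2" if "x \<in> P \<inter> ball p (\<delta>/4)" "y \<in> P \<inter> ball p (\<delta>/4)" for x y
        using dist_triangle2[of x y p] that by (simp add: dist_commute dist_norm)
    qed
    then have "\<exists>B\<in>\<C>. P \<inter> ball p (\<delta>/4) \<subseteq> B" using \<delta>(1) by (intro \<delta>(2)) auto
    then show ?thesis unfolding \<C>_def using proj_in_P by blast
  qed
  then show ?thesis using that[of "\<delta>/4"] \<delta>(1) by simp
qed

lemma reflective_orientable:
  assumes refl: "reflective \<epsilon>"
  shows "orientable A"
proof -
  obtain \<rho> where \<rho>: "\<rho> > 0"
    and "\<forall>p\<in>P. \<exists>c \<theta>. std c \<theta> \<and> (\<forall>z. proj z \<in> ball p \<rho> \<longrightarrow> z \<in> cdom c)"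
    by (rule uniform_standard_charts)
  then obtain C \<Theta> where C: "\<And>p. p \<in> P \<Longrightarrow> std (C p) (\<Theta> p)"
    and dom: "\<And>p z. p \<in> P \<Longrightarrow> proj z \<in> ball p \<rho> \<Longrightarrow> z \<in> cdom (C p)"
    by metis
  have conv: "convex P" using polytope_P by (rule polytope_imp_convex)
  have bd: "bounded P" using polytope_P by (rule polytope_imp_bounded)
  define \<xi> where "\<xi> p = (SOME z. proj z = p)" for p
  have \<xi>: "proj (\<xi> p) = p" if p: "p \<in> P" for p
  proof -
    obtain z where "proj z = p" using p proj_image by blast
    then show ?thesis unfolding \<xi>_def by (rule someI)
  qed
  define u where "u p x = correction \<epsilon> (C p) (\<Theta> p) x" for p x
  \<comment> \<open>\<open>\<kappa>\<close> is the constant value of the comparison sign over the intersection of two balls.\<close>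
  define \<tau> where "\<tau> p q x = discrepancy \<epsilon> (C p) (\<Theta> p) (C q) (\<Theta> q) x" for p q x
  define \<kappa> where "\<kappa> p q = \<tau> p q (\<xi> p)" for p q
  have \<tau>_const: "\<tau> p q x = \<kappa> p q"
    if "p \<in> P" "q \<in> P" "dist p q < \<rho>" "proj x \<in> ball p \<rho>" "proj x \<in> ball q \<rho>" for p q x
    unfolding \<kappa>_def \<tau>_def
  proof (rule discrepancy_constant[OF refl C[OF that(1)] C[OF that(2)], where T = "P \<inter> ball p \<rho> \<inter> ball q \<rho>"])
    show "convex (P \<inter> ball p \<rho> \<inter> ball q \<rho>)" by (intro convex_Int conv convex_ball)
    show "z \<in> cdom (C p) \<and> z \<in> cdom (C q)" if "proj z \<in> P \<inter> ball p \<rho> \<inter> ball q \<rho>" for z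
      using that dom \<open>p \<in> P\<close> \<open>q \<in> P\<close> by blast
    show "proj x \<in> P \<inter> ball p \<rho> \<inter> ball q \<rho>" using that proj_in_P by blast
    show "proj (\<xi> p) \<in> P \<inter> ball p \<rho> \<inter> ball q \<rho>"
      using that(1,3) \<rho> by (simp add: \<xi> dist_commute)
  qed blast
  obtain a where a: "\<And>p. p \<in> P \<Longrightarrow> a p = 1 \<or> a p = -1"
    and \<kappa>a: "\<And>p q. p \<in> P \<Longrightarrow> q \<in> P \<Longrightarrow> dist p q < \<rho> / 2 \<Longrightarrow> \<kappa> p q = a p * a q"
  proof (rule cocycle_convex[OF conv bd \<rho>, of \<kappa>])
    fix p q assume pq: "p \<in> P" "q \<in> P" "dist p q < \<rho>"
    then have "proj (\<xi> p) \<in> ball p \<rho>" "proj (\<xi> p) \<in> ball q \<rho>" using \<rho> by (simp_all add: \<xi> dist_commute)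
    then show "\<kappa> p q = 1 \<or> \<kappa> p q = -1"
      unfolding \<kappa>_def \<tau>_def using pq by (intro discrepancy_cases refl C dom)
  next
    fix p q r assume pqr: "p \<in> P" "q \<in> P" "r \<in> P" and d: "dist p q < \<rho>" "dist q r < \<rho>" "dist p r < \<rho>"
    have p: "proj (\<xi> p) \<in> ball p \<rho>" "proj (\<xi> p) \<in> ball q \<rho>" "proj (\<xi> p) \<in> ball r \<rho>"
      using pqr d \<rho> by (simp_all add: \<xi> dist_commute)
    have "\<kappa> p q * \<kappa> q r = \<tau> p q (\<xi> p) * \<tau> q r (\<xi> p)"
      using \<tau>_const[OF pqr(2,3) d(2) p(2,3)] by (simp add: \<kappa>_def)
    also have "\<dots> = \<kappa> p r"
      unfolding \<kappa>_def \<tau>_def using pqr p by (intro discrepancy_compose refl C dom)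
    finally show "\<kappa> p q * \<kappa> q r = \<kappa> p r" .
  qed (use that in blast)

  \<comment> \<open>\<open>\<sigma> p\<close> is the sign by which the chart \<open>C p\<close> differs from the global orientation.\<close>
  define \<sigma> where "\<sigma> p x = a p * u p x" for p x
  have \<sigma>_cases: "\<sigma> p x = 1 \<or> \<sigma> p x = -1" if "p \<in> P" "x \<in> cdom (C p)" for p x
    using a[OF that(1)] correction_cases[OF refl C[OF that(1)] that(2)] by (auto simp: \<sigma>_def u_def)
  have jac: "jac_sign (C p) (C q) x = \<sigma> p x * \<sigma> q x"
    if p: "p \<in> P" "proj x \<in> ball p (\<rho>/4)" and q: "q \<in> P" "proj x \<in> ball q (\<rho>/4)" for p q x
  proof -
    have pq: "dist p q < \<rho> / 2"
      using dist_triangle[of p q "proj x"] p(2) q(2) by (simp add: dist_commute)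
    have mem: "proj x \<in> ball p \<rho>" "proj x \<in> ball q \<rho>" using p(2) q(2) \<rho> by auto
    have xd: "x \<in> cdom (C p)" "x \<in> cdom (C q)" using dom p(1) q(1) mem by blast+
    have "u p x * u q x * jac_sign (C p) (C q) x = a p * a q"
      using \<tau>_const[OF p(1) q(1) _ mem] \<kappa>a[OF p(1) q(1) pq] pq \<rho>
      by (simp add: \<tau>_def discrepancy_def u_def)
    moreover have "u p x = 1 \<or> u p x = -1" "u q x = 1 \<or> u q x = -1"
      unfolding u_def using correction_cases[OF refl] C p(1) q(1) xd by blast+
    ultimately show ?thesis by (auto simp: \<sigma>_def)
  qed

  define D where "D p g = {x \<in> cdom (C p). proj x \<in> ball p (\<rho>/4) \<and> \<sigma> p x = total_sign g}"
    for p and g :: "bit^'n"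
  have D_sub: "D p g \<subseteq> cdom (C p)" for p g by (auto simp: D_def)
  have D_open: "open (D p g)" if p: "p \<in> P" for p g
  proof (subst open_subopen, intro ballI)
    fix x assume x: "x \<in> D p g"
    then have xc: "x \<in> cdom (C p)" using D_sub by blast
    obtain V where V: "open V" "x \<in> V" "V \<subseteq> cdom (C p)"
      "\<forall>y\<in>V. correction \<epsilon> (C p) (\<Theta> p) y = correction \<epsilon> (C p) (\<Theta> p) x"
      using correction_locally_constant[OF refl C[OF p] xc] .
    have "open (proj -` ball p (\<rho>/4))"
      using proj_continuous by (simp add: continuous_on_open_vimage[OF open_UNIV])
    then have "open (V \<inter> proj -` ball p (\<rho>/4))" using V(1) by blast
    moreover have "V \<inter> proj -` ball p (\<rho>/4) \<subseteq> D p g"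
    proof
      fix y assume y: "y \<in> V \<inter> proj -` ball p (\<rho>/4)"
      then have "\<sigma> p y = \<sigma> p x" using V(4) by (simp add: \<sigma>_def u_def)
      then show "y \<in> D p g" using y x V(3) by (auto simp: D_def)
    qed
    moreover have "x \<in> V \<inter> proj -` ball p (\<rho>/4)" using V(2) x by (simp add: D_def)
    ultimately show "\<exists>T. open T \<and> x \<in> T \<and> T \<subseteq> D p g" by blast
  qed
  have CM: "C p \<in> M" if "p \<in> P" for p using stdD(1)[OF C[OF that]] .

  define B where "B = {signed_chart (C p) g (D p g) | p g. p \<in> P}"
  show ?thesis
  proof (rule orientableI[of B])
    show "B \<subseteq> M"
      unfolding B_def using signed_chart_smooth[OF CM D_open D_sub] by blast
    show "(\<Union>c\<in>B. cdom c) = UNIV"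
    proof (intro equalityI subset_UNIV subsetI)
      fix x
      let ?p = "proj x"
      have p: "?p \<in> P" "?p \<in> ball ?p (\<rho>/4)" "?p \<in> ball ?p \<rho>" using proj_in_P \<rho> by auto
      obtain k :: 'n where True by blast
      have "\<exists>g. \<sigma> ?p x = total_sign (g :: bit^'n)"
        using \<sigma>_cases[OF p(1) dom[OF p(1,3)]] total_sign_axis[of k] total_sign_square[of "axis k 1"]
        by (metis bit_vec_add_self total_sign_add)
      then obtain g where "x \<in> D ?p g" unfolding D_def using p dom by blast
      then have "signed_chart (C ?p) g (D ?p g) \<in> B" "x \<in> cdom (signed_chart (C ?p) g (D ?p g))"
        unfolding B_def using p(1) by auto
      then show "x \<in> (\<Union>c\<in>B. cdom c)" by blast
    qed
    fix c d x assume c: "c \<in> B" and d: "d \<in> B" and x: "x \<in> cdom c" "x \<in> cdom d"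
    obtain p g where p: "p \<in> P" "c = signed_chart (C p) g (D p g)" using c unfolding B_def by blast
    obtain q k where q: "q \<in> P" "d = signed_chart (C q) k (D q k)" using d unfolding B_def by blast
    have xD: "x \<in> D p g" "x \<in> D q k" using x p q by simp_all
    have "jac_sign c d x = total_sign g * total_sign k * jac_sign (C p) (C q) x"
      unfolding p(2) q(2)
      by (rule jac_sign_signed_chart[OF CM[OF p(1)] D_open[OF p(1)] D_sub CM[OF q(1)] D_open[OF q(1)] D_sub xD])
    also have "jac_sign (C p) (C q) x = total_sign g * total_sign k"
      using jac[OF p(1) _ q(1)] xD by (simp add: D_def)
    finally show "jac_sign c d x = 1"
      using total_sign_cases[of g] total_sign_cases[of k] by auto
  qed
qed


section \<open>Existence and uniqueness\<close>

text \<open>Each reflection also acts as a reflection at a global fixed point, where general position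
  excludes it from \<open>G\<close>.\<close>

lemma two_subtorus_reflective:
  assumes G: "two_subtorus_in_general_position A act G"
  shows "reflective (subgroup_char G)"
  unfolding reflective_def
proof (intro conjI ballI)
  have "index2_subgroup G" using G by (simp add: two_subtorus_in_general_position_def)
  then show "additive (subgroup_char G)" by (rule index2_subgroup_char)
  fix r assume r: "r \<in> reflections"
  then have r0: "r \<noteq> 0" by (simp add: reflections_def)
  obtain x where x: "x \<in> mirror r" and fixed: "\<forall>g. act g x = x" using reflection_at_fixed_point[OF r] .
  obtain c \<theta> where c: "std c \<theta>" "x \<in> cdom c" by (rule std_exists)
  obtain i where i: "\<theta> r = axis i 1" using mirror_std_iff[OF c r0] x by blast
  have "inv \<theta> (axis i 1) \<notin> G" by (rule general_position_no_reflection[OF G fixed[rule_format] c])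
  then show "subgroup_char G r = 1"
    using automorphism_inv_inv[OF stdD(3)[OF c(1)], of r] i by (simp add: subgroup_char_def)
qed

lemma reflection_exists: obtains r where "r \<in> reflections"
proof -
  obtain x where x: "\<forall>g. act g x = x" by (rule global_fixed_point_exists)
  obtain c \<theta> where c: "std c \<theta>" "x \<in> cdom c" by (rule std_exists)
  obtain i :: 'n where True by blast
  have "act (inv \<theta> (axis i 1)) x = x" using x by blast
  then have "cmap c x $ i = 0"
    unfolding std_fixed_iff[OF c] automorphism_inv[OF stdD(3)[OF c(1)]] by (simp add: axis_def)
  then show ?thesis using that std_wall_mirror(1)[OF c] by blast
qed

lemma reflective_two_subtorus:
  assumes "reflective \<epsilon>"
  shows "two_subtorus_in_general_position A act {g. \<epsilon> g = 0}"
proof -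
  obtain r where "r \<in> reflections" by (rule reflection_exists)
  then have "index2_subgroup {g. \<epsilon> g = 0}"
    using assms unfolding reflective_def by (intro additive_kernel_index2[of \<epsilon> r]) auto
  then show ?thesis
    using reflective_general_position[OF assms] by (simp add: two_subtorus_in_general_position_def)
qed

lemma reflective_unique:
  assumes \<epsilon>: "reflective \<epsilon>" and \<delta>: "reflective \<delta>"
  shows "\<epsilon> = \<delta>"
proof
  fix g
  obtain x where x: "\<forall>g. act g x = x" by (rule global_fixed_point_exists)
  obtain c \<theta> where c: "std c \<theta>" "x \<in> cdom c" by (rule std_exists)
  note \<theta> = stdD(3)[OF c(1)]
  have zero: "cmap c x $ i = 0" for i
    using x[rule_format, of "inv \<theta> (axis i 1)"]
    unfolding std_fixed_iff[OF c] automorphism_inv[OF \<theta>] by (simp add: axis_def)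
  have "\<epsilon> (inv \<theta> (axis i 1)) = \<delta> (inv \<theta> (axis i 1))" for i
    using reflective_axis[OF \<epsilon> c zero] reflective_axis[OF \<delta> c zero] by simp
  then show "\<epsilon> g = \<delta> g"
    using additive_coordinates[OF _ \<theta>, of \<epsilon> g] additive_coordinates[OF _ \<theta>, of \<delta> g] \<epsilon> \<delta>
    by (simp add: reflective_def)
qed

lemma two_subtorus_iff_orientable:
  "(\<exists>G. two_subtorus_in_general_position A act G) \<longleftrightarrow> orientable A"
proof
  assume "\<exists>G. two_subtorus_in_general_position A act G"
  then obtain G where "two_subtorus_in_general_position A act G" ..
  then have "reflective (subgroup_char G)" by (rule two_subtorus_reflective)
  then show "orientable A" by (rule reflective_orientable)
next
  assume "orientable A"
  then obtain \<epsilon> where "reflective \<epsilon>" using orientable_reflective[OF connected_X] by auto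
  then have "two_subtorus_in_general_position A act {g. \<epsilon> g = 0}" by (rule reflective_two_subtorus)
  then show "\<exists>G. two_subtorus_in_general_position A act G" ..
qed

lemma two_subtorus_unique:
  assumes "two_subtorus_in_general_position A act G" "two_subtorus_in_general_position A act H"
  shows "G = H"
proof -
  have "subgroup_char G = subgroup_char H"
    by (rule reflective_unique[OF two_subtorus_reflective[OF assms(1)] two_subtorus_reflective[OF assms(2)]])
  then show ?thesis using subgroup_char_kernel by metis
qed

end

theorem theorem2:
  fixes A :: "('x::{t2_space, second_countable_topology}, 'n::finite) chart set"
    and act :: "bit^'n \<Rightarrow> 'x \<Rightarrow> 'x"
    and P :: "(real^'n) set"
  assumes "small_cover A act P"
  shows "((\<exists>G. two_subtorus_in_general_position A act G) \<longleftrightarrow> orientable A) \<and>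
         ((\<exists>G. two_subtorus_in_general_position A act G) \<longrightarrow>
          (\<exists>!G. two_subtorus_in_general_position A act G))"
proof -
  obtain h where h: "orbit_space_diffeo A act P h" using assms unfolding small_cover_def by blast
  interpret small_cover_mfd A act P h
  proof unfold_locales
    show "smooth_atlas A" "smooth_action A act" "locally_standard A act"
      "compact (UNIV :: 'x set)" "connected (UNIV :: 'x set)" "polytope P"
      using assms by (simp_all add: small_cover_def simple_polytope_def)
  qed (rule h)
  have "\<exists>!G. two_subtorus_in_general_position A act G"
    if G: "two_subtorus_in_general_position A act G" for G
    by (rule ex1I[of _ G]) (use G two_subtorus_unique in auto)
  then show ?thesis
    using two_subtorus_iff_orientable by auto
qed

end
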